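(* Let $\boldsymbol p=(p,0)$ or $\boldsymbol p=(0,p)$ with $p\in\mathbb N=\{1,2,\dots\}$. If $W:\mathcal B(\mathcal H_{\boldsymbol p})\to C^\infty_{\mathbb C}(\mathbb CP^2)$ is a symbol correspondence with characteristic numbers $(c_n)$, then the induced twisted product is given by $$X^{n_1}_{\boldsymbol\nu_1,J_1}\star X^{n_2}_{\boldsymbol\nu_2,J_2}=\sqrt{\dim(\boldsymbol p)}\sum_{n=0}^p\sum_{\boldsymbol\nu,J}(-1)^{p+2(t_{\boldsymbol\nu}+u_{\boldsymbol\nu})}\begin{bmatrix}n_1&n_2&n\\ \boldsymbol\nu_1,J_1&\boldsymbol\nu_2,J_2&\check{\boldsymbol\nu},J\end{bmatrix}[\boldsymbol p]\;\frac{c_n}{c_{n_1}c_{n_2}}\,X^n_{\boldsymbol\nu,J}$$ for $0\le n_1,n_2\le p$, where summations over $\boldsymbol\nu$ and $J$ are effectively restricted to $t_{\boldsymbol\nu}=t_{\boldsymbol\nu_1}+t_{\boldsymbol\nu_2}$, $u_{\boldsymbol\nu}=u_{\boldsymbol\nu_1}+u_{\boldsymbol\nu_2}$ and $\delta(J_1,J_2,J)=1$.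
   Context: Representations. In a representation of $SU(3)$ (extended to $\mathfrak{sl}(3,\mathbb C)$) let $T_+,T_-,T_3,U_+,U_-,U_3$ be the images of $E_{12},E_{21},\tfrac12(E_{11}-E_{22}),E_{23},E_{32},\tfrac12(E_{22}-E_{33})$. For $\boldsymbol p=(p,q)\in\mathbb N_0^2$, "the irrep $\boldsymbol p$" is the unitary irrep on $\mathcal H_{\boldsymbol p}$ whose highest weight vector has eigenvalue $p/2$ for $T_3$ and $q/2$ for $U_3$; $\dim(\boldsymbol p)=\frac{(p+1)(q+1)(p+q+2)}2$, $|\boldsymbol p|=p+q$, $\check{\boldsymbol p}=(q,p)$ (the dual irrep). Inner products are linear in the second entry. Gelfand-Tsetlin (GT) basis: an orthonormal basis $\{\boldsymbol e(\boldsymbol p;\boldsymbol\nu,J)\}$ indexed by $\boldsymbol\nu=(\nu_1,\nu_2,\nu_3)$ and $J$ where, for integers $0\le r_-\le q\le r_+\le p+q$ and $r_-\le\nu_3\le r_+$: $\nu_1=p+2q-(r_++r_-)$, $\nu_2=r_++r_--\nu_3$, $J=\frac12(r_+-r_-)$. Put $t_{\boldsymbol\nu}=\frac{\nu_1-\nu_2}2$, $u_{\boldsymbol\nu}=\frac{\nu_2-\nu_3}2$ (the eigenvalues of $T_3,U_3$). The basis is determined by a unit highest weight vector $\boldsymbol e(\boldsymbol p;(p+q,q,0),q/2)$ via, with $u=u_{\boldsymbol\nu}$, $U_-\boldsymbol e(\boldsymbol p;\boldsymbol\nu,J)=\sqrt{(J+u)(J-u+1)}\,\boldsymbol e(\boldsymbol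 p;(\nu_1,\nu_2-1,\nu_3+1),J)$ and $T_-\boldsymbol e(\boldsymbol p;\boldsymbol\nu,J)=\sqrt{\tfrac{(J-u)(p+q+J-u-\nu_3+1)(q+J-u-\nu_3)(u-J+\nu_3+1)}{2J(2J+1)}}\,\boldsymbol e(\boldsymbol p;(\nu_1-1,\nu_2+1,\nu_3),J-\tfrac12)+\sqrt{\tfrac{(J+u+1)(p+q-J-u-\nu_3)(J+u+1+\nu_3-q)(J+u+2+\nu_3)}{2(J+1)(2J+1)}}\,\boldsymbol e(\boldsymbol p;(\nu_1-1,\nu_2+1,\nu_3),J+\tfrac12)$ (terms with zero numerator are $0$). For $\boldsymbol p=(p,0)$ or $(0,p)$, $J$ is determined by $\boldsymbol\nu$ and is omitted. For a GT label $\boldsymbol\nu$ of an irrep $\boldsymbol a$ put $\check{\boldsymbol\nu}=(|\boldsymbol a|,|\boldsymbol a|,|\boldsymbol a|)-\boldsymbol\nu$ (so $(2n,2n,2n)-\boldsymbol\nu$ for $\boldsymbol a=(n,n)$). The induced GT basis of $\mathcal H_{\check{\boldsymbol p}}=\mathcal H_{\boldsymbol p}^*$ is $\check{\boldsymbol e}(\check{\boldsymbol p};\check{\boldsymbol\nu},J)=(-1)^{2(t_{\boldsymbol\nu}+u_{\boldsymbol\nu})}\boldsymbol e^*(\boldsymbol p;\boldsymbol\nu,J)$. Wigner functions: $D^{\boldsymbol a}_{\boldsymbol\nu J,\boldsymbol\mu L}(g)=\langle\boldsymbol e(\boldsymbol a;\boldsymbol\nu,J)|\rho(g)\boldsymbol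 e(\boldsymbol a;\boldsymbol\mu,L)\rangle$. Coupled basis. For $\boldsymbol p=(p,0)$ or $(0,p)$, $\mathcal B(\mathcal H_{\boldsymbol p})\simeq\mathcal H_{\boldsymbol p}\otimes\mathcal H_{\boldsymbol p}^*=\bigoplus_{n=0}^p(n,n)$ under $A^g=\rho(g)A\rho(g)^{-1}$, with inner product $\operatorname{tr}(A^\dagger B)$; $\{\boldsymbol e(n;\boldsymbol\nu,J)\}$ is the union of GT bases of the summands $(n,n)$, with phases such that all Clebsch-Gordan coefficients $C^{\boldsymbol p,\check{\boldsymbol p},n}_{\boldsymbol\nu_1,\boldsymbol\nu_2,\boldsymbol\nu J}=\langle\boldsymbol e(n;\boldsymbol\nu,J)|\boldsymbol e(\boldsymbol p;\boldsymbol\nu_1)\otimes\check{\boldsymbol e}(\check{\boldsymbol p};\boldsymbol\nu_2)\rangle$ are real and $\boldsymbol e(0;(0,0,0),0)=\mathds 1/\sqrt{\dim\boldsymbol p}$. Wigner product symbol: $$\begin{bmatrix}n_1&n_2&n\\ \boldsymbol\nu_1,J_1&\boldsymbol\nu_2,J_2&\boldsymbol\nu,J\end{bmatrix}[\boldsymbol p]=\sum_{\boldsymbol\mu_1,\boldsymbol\mu_2,\boldsymbol\mu_3}(-1)^{|\boldsymbol p|+2(t_{\boldsymbol\nu}+t_{\boldsymbol\mu_2}+u_{\boldsymbol\nu}+u_{\boldsymbol\mu_2})}C^{\boldsymbol p,\check{\boldsymbol p},n_1}_{\boldsymbol\mu_1,\boldsymbol\mu_2,\boldsymbol\nu_1J_1}C^{\boldsymbol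 p,\check{\boldsymbol p},n_2}_{\check{\boldsymbol\mu}_2,\boldsymbol\mu_3,\boldsymbol\nu_2J_2}C^{\boldsymbol p,\check{\boldsymbol p},n}_{\boldsymbol\mu_1,\boldsymbol\mu_3,\check{\boldsymbol\nu}J},$$ the sum being over GT labels $\boldsymbol\mu_1$ of $\boldsymbol p$ and $\boldsymbol\mu_2,\boldsymbol\mu_3$ of $\check{\boldsymbol p}$. $\delta(x,y,z)=1$ if $x,y,z$ satisfy the triangle inequality and $x+y+z\in\mathbb Z$, and $0$ otherwise. Symbol correspondences. $\mathbb CP^2\simeq SU(3)/H$, $H=\{\mathrm{diag}(\det(U)^{-1},U):U\in U(2)\}$ the isotropy group of $\mathrm x_0=[1:0:0]$, with the invariant integral of total mass $1$. Harmonics: $X^n_{\boldsymbol\nu,J}(g\mathrm x_0)=(n+1)^{3/2}\,\overline{D^{(n,n)}_{\boldsymbol\nu J,(n,n,n)0}(g)}$. A symbol correspondence $W:\mathcal B(\mathcal H_{\boldsymbol p})\to C^\infty_{\mathbb C}(\mathbb CP^2)$ is an injective linear map with: (1) $W_{A^g}=(W_A)^g$, where $f^g(\mathrm x)=f(g^{-1}\mathrm x)$; (2) $W_{A^\dagger}=\overline{W_A}$; (3) $\int W_A\,d\mathrm x=\operatorname{tr}(A)/\dim(\boldsymbol p)$. Each has characteristic numbers $c_0=1$, $c_1,\dots,c_p\in\mathbb R^\times$, defined by $W:\sqrt{\dim\boldsymbol p}\,\boldsymbol e(n;\boldsymbol\nu,J)\mapsto c_nX^n_{\boldsymbol\nu,J}$.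 The twisted product induced by $W$ is the product $\star$ on the image of $W$ (the span of the $X^n_{\boldsymbol\nu,J}$, $0\le n\le p$) given by $W_{A_1}\star W_{A_2}=W_{A_1A_2}$. *)

theory Defs
  imports "HOL-Analysis.Analysis"
begin

section \<open>Finite-dimensional complex inner product spaces\<close>

text \<open>
  A common interface for vectors in \<open>complex ^ 'd\<close> and operators in \<open>complex ^ 'd ^ 'd\<close>.
  The inner product is linear in the second entry and its real part is the
  Euclidean inner product; finite-dimensionality comes from the class \<open>euclidean_space\<close>.
\<close>

class chilbert = euclidean_space +
  fixes cscale :: "complex \<Rightarrow> 'a \<Rightarrow> 'a"
    and cinner :: "'a \<Rightarrow> 'a \<Rightarrow> complex"
  assumes cscale_add_right: "cscale a (x + y) = cscale a x + cscale a y"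
    and cscale_add_left: "cscale (a + b) x = cscale a x + cscale b x"
    and cscale_cscale: "cscale a (cscale b x) = cscale (a * b) x"
    and cscale_of_real: "cscale (complex_of_real r) x = r *\<^sub>R x"
    and cinner_commute: "cinner x y = cnj (cinner y x)"
    and cinner_add_right: "cinner x (y + z) = cinner x y + cinner x z"
    and cinner_cscale_right: "cinner x (cscale a y) = a * cinner x y"
    and Re_cinner: "Re (cinner x y) = inner x y"

instantiation complex :: chilbert
begin
definition cscale_complex :: "complex \<Rightarrow> complex \<Rightarrow> complex"
  where "cscale_complex a x = a * x"
definition cinner_complex :: "complex \<Rightarrow> complex \<Rightarrow> complex"
  where "cinner_complex x y = cnj x * y"
instance
  by standard
    (auto simp: cscale_complex_def cinner_complex_def algebra_simps scaleR_conv_of_real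
      inner_complex_def)
end

instantiation vec :: (chilbert, finite) chilbert
begin
definition cscale_vec :: "complex \<Rightarrow> 'a ^ 'b \<Rightarrow> 'a ^ 'b"
  where "cscale_vec a x = (\<chi> i. cscale a (x $ i))"
definition cinner_vec :: "'a ^ 'b \<Rightarrow> 'a ^ 'b \<Rightarrow> complex"
  where "cinner_vec x y = (\<Sum>i\<in>UNIV. cinner (x $ i) (y $ i))"
instance
proof
  fix x y z :: "'a ^ 'b" and a b :: complex and r :: real
  show "cscale a (x + y) = cscale a x + cscale a y"
    by (simp add: cscale_vec_def vec_eq_iff cscale_add_right)
  show "cscale (a + b) x = cscale a x + cscale b x"
    by (simp add: cscale_vec_def vec_eq_iff cscale_add_left)
  show "cscale a (cscale b x) = cscale (a * b) x"
    by (simp add: cscale_vec_def vec_eq_iff cscale_cscale)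
  show "cscale (complex_of_real r) x = r *\<^sub>R x"
    by (simp add: cscale_vec_def vec_eq_iff cscale_of_real)
  show "cinner x y = cnj (cinner y x)"
    unfolding cinner_vec_def cnj_sum by (rule sum.cong[OF refl]) (rule cinner_commute)
  show "cinner x (y + z) = cinner x y + cinner x z"
    by (simp add: cinner_vec_def cinner_add_right sum.distrib)
  show "cinner x (cscale a y) = a * cinner x y"
    by (simp add: cinner_vec_def cscale_vec_def cinner_cscale_right sum_distrib_left)
  show "Re (cinner x y) = inner x y"
    by (simp add: cinner_vec_def inner_vec_def Re_cinner)
qed
end

definition csubspace :: "'v::chilbert set \<Rightarrow> bool" where
  "csubspace V \<longleftrightarrow>
     0 \<in> V \<and> (\<forall>x\<in>V. \<forall>y\<in>V. x + y \<in> V) \<and> (\<forall>a. \<forall>x\<in>V. cscale a x \<in> V)"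

definition dagger :: "complex ^ 'n ^ 'n \<Rightarrow> complex ^ 'n ^ 'n" where
  "dagger A = (\<chi> i j. cnj (A $ j $ i))"

lemma cinner_operator: "cinner A B = trace (dagger A ** B)"
  for A B :: "complex ^ 'n ^ 'n"
  unfolding cinner_vec_def cinner_complex_def trace_def matrix_matrix_mult_def dagger_def
  by simp (rule sum.swap)


section \<open>Unitary representations of SU(3)\<close>

definition SU3 :: "(complex ^ 3 ^ 3) set" where
  "SU3 = {g. dagger g ** g = mat 1 \<and> det g = 1}"

text \<open>
  Representations of Lie groups are smooth. Only differentiability is asked for here; for
  a homomorphism, continuity, differentiability and smoothness are equivalent.
\<close>

definition unitary_rep :: "(complex ^ 3 ^ 3 \<Rightarrow> 'v::chilbert \<Rightarrow> 'v) \<Rightarrow> bool" where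
  "unitary_rep R \<longleftrightarrow>
     (\<forall>g\<in>SU3. (\<forall>x y. R g (x + y) = R g x + R g y) \<and>
              (\<forall>a x. R g (cscale a x) = cscale a (R g x)) \<and>
              (\<forall>x y. cinner (R g x) (R g y) = cinner x y)) \<and>
     R (mat 1) = id \<and>
     (\<forall>g\<in>SU3. \<forall>h\<in>SU3. R (g ** h) = R g \<circ> R h) \<and>
     (\<forall>v. (\<lambda>g. R g v) differentiable_on SU3)"

definition mexp :: "complex ^ 3 ^ 3 \<Rightarrow> complex ^ 3 ^ 3" where
  "mexp A = (\<Sum>k. (1 / fact k) *\<^sub>R ((\<lambda>B. A ** B) ^^ k) (mat 1))"

text \<open>
  \<open>lie_su R\<close> is the derived representation of su(3). Its complex-linear extension to
  sl(3,C) is \<open>lie_sl R\<close>, by \<open>Z = A + \<i> B\<close> with \<open>A = (Z - Z\<^sup>\<dagger>) / 2\<close>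
  and \<open>B = - \<i> (Z + Z\<^sup>\<dagger>) / 2\<close> both in su(3).
\<close>

definition lie_su :: "(complex ^ 3 ^ 3 \<Rightarrow> 'v::chilbert \<Rightarrow> 'v) \<Rightarrow> complex ^ 3 ^ 3 \<Rightarrow> 'v \<Rightarrow> 'v" where
  "lie_su R X v = vector_derivative (\<lambda>t. R (mexp (t *\<^sub>R X)) v) (at 0)"

definition lie_sl :: "(complex ^ 3 ^ 3 \<Rightarrow> 'v::chilbert \<Rightarrow> 'v) \<Rightarrow> complex ^ 3 ^ 3 \<Rightarrow> 'v \<Rightarrow> 'v" where
  "lie_sl R Z v =
     lie_su R (cscale (1 / 2) (Z - dagger Z)) v +
     cscale \<i> (lie_su R (cscale (- \<i> / 2) (Z + dagger Z)) v)"

definition E_unit :: "3 \<Rightarrow> 3 \<Rightarrow> complex ^ 3 ^ 3" where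
  "E_unit i j = (\<chi> k l. if k = i \<and> l = j then 1 else 0)"

definition T_plus  where "T_plus R  = lie_sl R (E_unit 1 2)"
definition T_minus where "T_minus R = lie_sl R (E_unit 2 1)"
definition T_three where "T_three R = lie_sl R (cscale (1 / 2) (E_unit 1 1 - E_unit 2 2))"
definition U_plus  where "U_plus R  = lie_sl R (E_unit 2 3)"
definition U_minus where "U_minus R = lie_sl R (E_unit 3 2)"
definition U_three where "U_three R = lie_sl R (cscale (1 / 2) (E_unit 2 2 - E_unit 3 3))"

definition highest_weight_vector ::
    "(complex ^ 3 ^ 3 \<Rightarrow> 'v::chilbert \<Rightarrow> 'v) \<Rightarrow> nat \<Rightarrow> nat \<Rightarrow> 'v \<Rightarrow> bool" where
  "highest_weight_vector R p q v \<longleftrightarrow>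
     v \<noteq> 0 \<and> T_plus R v = 0 \<and> U_plus R v = 0 \<and>
     T_three R v = (real p / 2) *\<^sub>R v \<and> U_three R v = (real q / 2) *\<^sub>R v"

definition invariant_subspace ::
    "(complex ^ 3 ^ 3 \<Rightarrow> 'v::chilbert \<Rightarrow> 'v) \<Rightarrow> 'v set \<Rightarrow> bool" where
  "invariant_subspace R V \<longleftrightarrow> csubspace V \<and> (\<forall>g\<in>SU3. \<forall>v\<in>V. R g v \<in> V)"

definition irrep_on ::
    "(complex ^ 3 ^ 3 \<Rightarrow> 'v::chilbert \<Rightarrow> 'v) \<Rightarrow> 'v set \<Rightarrow> nat \<Rightarrow> nat \<Rightarrow> bool" where
  "irrep_on R V p q \<longleftrightarrow>
     unitary_rep R \<and> invariant_subspace R V \<and>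
     (\<forall>V'. invariant_subspace R V' \<and> V' \<subseteq> V \<longrightarrow> V' = {0} \<or> V' = V) \<and>
     (\<exists>v\<in>V. highest_weight_vector R p q v)"

definition irrep_dim :: "nat \<Rightarrow> nat \<Rightarrow> real" where
  "irrep_dim p q = (real p + 1) * (real q + 1) * (real p + real q + 2) / 2"


section \<open>Gelfand-Tsetlin bases\<close>

type_synonym nu = "int \<times> int \<times> int"

fun t_of :: "nu \<Rightarrow> real" where
  "t_of (\<nu>1, \<nu>2, \<nu>3) = (real_of_int \<nu>1 - real_of_int \<nu>2) / 2"

fun u_of :: "nu \<Rightarrow> real" where
  "u_of (\<nu>1, \<nu>2, \<nu>3) = (real_of_int \<nu>2 - real_of_int \<nu>3) / 2"

text \<open>The integer \<open>2 (t\<^sub>\<nu> + u\<^sub>\<nu>)\<close>, used as an exponent of \<open>-1\<close>.\<close>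

fun tu2 :: "nu \<Rightarrow> int" where
  "tu2 (\<nu>1, \<nu>2, \<nu>3) = \<nu>1 - \<nu>3"

lemma tu2_eq: "real_of_int (tu2 \<nu>) = 2 * (t_of \<nu> + u_of \<nu>)"
  by (cases \<nu>) (simp add: field_simps)

definition gt_labels :: "nat \<Rightarrow> nat \<Rightarrow> (nu \<times> real) set" where
  "gt_labels p q =
     {((\<nu>1, \<nu>2, \<nu>3), J) | \<nu>1 \<nu>2 \<nu>3 J. \<exists>r_minus r_plus :: int.
        0 \<le> r_minus \<and> r_minus \<le> int q \<and> int q \<le> r_plus \<and> r_plus \<le> int p + int q \<and>
        r_minus \<le> \<nu>3 \<and> \<nu>3 \<le> r_plus \<and>
        \<nu>1 = int p + 2 * int q - (r_plus + r_minus) \<and>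
        \<nu>2 = r_plus + r_minus - \<nu>3 \<and>
        J = (real_of_int r_plus - real_of_int r_minus) / 2}"

text \<open>The dual label \<open>((s, s, s) - \<nu>, J)\<close> of a label of an irrep \<open>a\<close> with \<open>s = |a|\<close>.\<close>

fun check :: "nat \<Rightarrow> nu \<Rightarrow> nu" where
  "check s (\<nu>1, \<nu>2, \<nu>3) = (int s - \<nu>1, int s - \<nu>2, int s - \<nu>3)"

definition gt_coeff_U :: "nu \<Rightarrow> real \<Rightarrow> real" where
  "gt_coeff_U \<nu> J = sqrt ((J + u_of \<nu>) * (J - u_of \<nu> + 1))"

text \<open>
  In the next two coefficients \<open>x / 0 = 0\<close> and the vanishing numerators implement the
  convention that terms with zero numerator are 0.
\<close>

fun gt_coeff_T_lower :: "nat \<Rightarrow> nat \<Rightarrow> nu \<Rightarrow> real \<Rightarrow> real" where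
  "gt_coeff_T_lower p q (\<nu>1, \<nu>2, \<nu>3) J =
     (let u = u_of (\<nu>1, \<nu>2, \<nu>3); v3 = real_of_int \<nu>3 in
      sqrt ((J - u) * (real p + real q + J - u - v3 + 1) * (real q + J - u - v3) *
              (u - J + v3 + 1) / (2 * J * (2 * J + 1))))"

fun gt_coeff_T_raise :: "nat \<Rightarrow> nat \<Rightarrow> nu \<Rightarrow> real \<Rightarrow> real" where
  "gt_coeff_T_raise p q (\<nu>1, \<nu>2, \<nu>3) J =
     (let u = u_of (\<nu>1, \<nu>2, \<nu>3); v3 = real_of_int \<nu>3 in
      sqrt ((J + u + 1) * (real p + real q - J - u - v3) * (J + u + 1 + v3 - real q) *
              (J + u + 2 + v3) / (2 * (J + 1) * (2 * J + 1))))"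

definition gt_basis ::
    "(complex ^ 3 ^ 3 \<Rightarrow> 'v::chilbert \<Rightarrow> 'v) \<Rightarrow> 'v set \<Rightarrow> nat \<Rightarrow> nat \<Rightarrow>
     (nu \<times> real \<Rightarrow> 'v) \<Rightarrow> bool" where
  "gt_basis R V p q e \<longleftrightarrow>
     irrep_on R V p q \<and>
     (\<forall>l\<in>gt_labels p q. \<forall>l'\<in>gt_labels p q. cinner (e l) (e l') = (if l = l' then 1 else 0)) \<and>
     V = {\<Sum>l\<in>gt_labels p q. cscale (a l) (e l) | a. True} \<and>
     highest_weight_vector R p q (e ((int p + int q, int q, 0), real q / 2)) \<and>
     (\<forall>\<nu>1 \<nu>2 \<nu>3 J. ((\<nu>1, \<nu>2, \<nu>3), J) \<in> gt_labels p q \<longrightarrow>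
        (let \<nu> = (\<nu>1, \<nu>2, \<nu>3) in
         T_three R (e (\<nu>, J)) = t_of \<nu> *\<^sub>R e (\<nu>, J) \<and>
         U_three R (e (\<nu>, J)) = u_of \<nu> *\<^sub>R e (\<nu>, J) \<and>
         U_minus R (e (\<nu>, J)) = gt_coeff_U \<nu> J *\<^sub>R e ((\<nu>1, \<nu>2 - 1, \<nu>3 + 1), J) \<and>
         T_minus R (e (\<nu>, J)) =
           gt_coeff_T_lower p q \<nu> J *\<^sub>R e ((\<nu>1 - 1, \<nu>2 + 1, \<nu>3), J - 1 / 2) +
           gt_coeff_T_raise p q \<nu> J *\<^sub>R e ((\<nu>1 - 1, \<nu>2 + 1, \<nu>3), J + 1 / 2)))"

definition wigner ::
    "(complex ^ 3 ^ 3 \<Rightarrow> 'v::chilbert \<Rightarrow> 'v) \<Rightarrow> (nu \<times> real \<Rightarrow> 'v) \<Rightarrow>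
     nu \<times> real \<Rightarrow> nu \<times> real \<Rightarrow> complex ^ 3 ^ 3 \<Rightarrow> complex" where
  "wigner R e l m g = cinner (e l) (R g (e m))"


section \<open>The coupled basis and the Wigner product symbol\<close>

text \<open>
  The space of the irrep is \<open>complex ^ 'd\<close>, so operators are matrices. A functional is given
  by its row of coefficients, and \<open>H \<otimes> H\<^sup>*\<close> is identified with operators through
  \<open>(v \<otimes> \<phi>) w = \<phi>(w) v\<close>.
\<close>

definition dual_vec :: "complex ^ 'd \<Rightarrow> complex ^ 'd" where
  "dual_vec v = (\<chi> j. cnj (v $ j))"

definition tensor_op :: "complex ^ 'd \<Rightarrow> complex ^ 'd \<Rightarrow> complex ^ 'd ^ 'd" where
  "tensor_op v \<phi> = (\<chi> i j. v $ i * \<phi> $ j)"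

definition conj_action ::
    "(complex ^ 3 ^ 3 \<Rightarrow> complex ^ 'd ^ 'd) \<Rightarrow> complex ^ 3 ^ 3 \<Rightarrow>
     complex ^ 'd ^ 'd \<Rightarrow> complex ^ 'd ^ 'd" where
  "conj_action \<rho> g A = \<rho> g ** A ** matrix_inv (\<rho> g)"

text \<open>
  The induced GT basis of the dual of an irrep with \<open>|p| = s\<close>, indexed by the labels of
  the dual irrep. Below, labels of \<open>(p, 0)\<close> and \<open>(0, p)\<close> keep their component \<open>J\<close>,
  which for these irreps is a function of \<open>\<nu>\<close>.
\<close>

fun dual_gt :: "nat \<Rightarrow> (nu \<times> real \<Rightarrow> complex ^ 'd) \<Rightarrow> nu \<times> real \<Rightarrow> complex ^ 'd" where
  "dual_gt s e (\<mu>, J) = cscale ((-1) powi tu2 (check s \<mu>)) (dual_vec (e (check s \<mu>, J)))"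

definition cg ::
    "nat \<Rightarrow> (nu \<times> real \<Rightarrow> complex ^ 'd) \<Rightarrow> (nat \<Rightarrow> nu \<times> real \<Rightarrow> complex ^ 'd ^ 'd) \<Rightarrow>
     nat \<Rightarrow> nu \<times> real \<Rightarrow> nu \<times> real \<Rightarrow> nu \<times> real \<Rightarrow> complex" where
  "cg s e E n l1 l2 l = cinner (E n l) (tensor_op (e l1) (dual_gt s e l2))"

definition coupled_basis ::
    "(complex ^ 3 ^ 3 \<Rightarrow> complex ^ 'd ^ 'd) \<Rightarrow> nat \<Rightarrow> nat \<Rightarrow> (nu \<times> real \<Rightarrow> complex ^ 'd) \<Rightarrow>
     (nat \<Rightarrow> nu \<times> real \<Rightarrow> complex ^ 'd ^ 'd) \<Rightarrow> bool" where
  "coupled_basis \<rho> p q e E \<longleftrightarrow>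
     (\<exists>V. (\<forall>n\<le>p + q. gt_basis (conj_action \<rho>) (V n) n n (E n)) \<and>
          (\<forall>m\<le>p + q. \<forall>n\<le>p + q. m \<noteq> n \<longrightarrow> (\<forall>A\<in>V m. \<forall>B\<in>V n. cinner A B = 0)) \<and>
          (\<forall>A. \<exists>B. (\<forall>n\<le>p + q. B n \<in> V n) \<and> A = (\<Sum>n\<le>p + q. B n))) \<and>
     (\<forall>n\<le>p + q. \<forall>l1\<in>gt_labels p q. \<forall>l2\<in>gt_labels q p. \<forall>l\<in>gt_labels n n.
        cg (p + q) e E n l1 l2 l \<in> \<real>) \<and>
     E 0 ((0, 0, 0), 0) = (1 / sqrt (irrep_dim p q)) *\<^sub>R mat 1"

definition wigner_product_symbol ::
    "nat \<Rightarrow> nat \<Rightarrow> (nu \<times> real \<Rightarrow> complex ^ 'd) \<Rightarrow> (nat \<Rightarrow> nu \<times> real \<Rightarrow> complex ^ 'd ^ 'd) \<Rightarrow>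
     nat \<Rightarrow> nat \<Rightarrow> nat \<Rightarrow> nu \<times> real \<Rightarrow> nu \<times> real \<Rightarrow> nu \<times> real \<Rightarrow> complex" where
  "wigner_product_symbol p q e E n1 n2 n l1 l2 = (\<lambda>(\<nu>, J).
     \<Sum>(\<mu>1, K1)\<in>gt_labels p q. \<Sum>(\<mu>2, K2)\<in>gt_labels q p. \<Sum>(\<mu>3, K3)\<in>gt_labels q p.
       (-1) powi (int (p + q) + tu2 \<nu> + tu2 \<mu>2) *
       cg (p + q) e E n1 (\<mu>1, K1) (\<mu>2, K2) l1 *
       cg (p + q) e E n2 (check (p + q) \<mu>2, K2) (\<mu>3, K3) l2 *
       cg (p + q) e E n (\<mu>1, K1) (\<mu>3, K3) (check (2 * n) \<nu>, J))"

definition tri_delta :: "real \<Rightarrow> real \<Rightarrow> real \<Rightarrow> nat" where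
  "tri_delta x y z =
     (if x \<le> y + z \<and> y \<le> x + z \<and> z \<le> x + y \<and> x + y + z \<in> \<int> then 1 else 0)"


section \<open>The complex projective plane\<close>

typedef cp2 = "{L :: (complex ^ 3) set. \<exists>z. z \<noteq> 0 \<and> L = range (\<lambda>a. a *s z)}"
proof -
  have "(axis 1 1 :: complex ^ 3) \<noteq> 0" by (simp add: axis_eq_0_iff)
  then show ?thesis by blast
qed

text \<open>Only meaningful for \<open>z \<noteq> 0\<close>.\<close>

definition proj :: "complex ^ 3 \<Rightarrow> cp2" where
  "proj z = Abs_cp2 (range (\<lambda>a. a *s z))"

definition base_point :: cp2 where
  "base_point = proj (axis 1 1)"

definition act :: "complex ^ 3 ^ 3 \<Rightarrow> cp2 \<Rightarrow> cp2" where
  "act g x = Abs_cp2 ((\<lambda>z. g *v z) ` Rep_cp2 x)"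

text \<open>Quotient topology of \<open>\<complex>\<^sup>3 - {0}\<close>.\<close>

instantiation cp2 :: topological_space
begin
definition open_cp2 :: "cp2 set \<Rightarrow> bool" where
  "open_cp2 S \<longleftrightarrow> open {z. z \<noteq> 0 \<and> proj z \<in> S}"
instance
proof
  have "{z :: complex ^ 3. z \<noteq> 0 \<and> proj z \<in> UNIV} = - {0}" by auto
  then show "open (UNIV :: cp2 set)" unfolding open_cp2_def by (simp add: open_Compl)
next
  fix S T :: "cp2 set" assume "open S" "open T"
  moreover have "{z. z \<noteq> 0 \<and> proj z \<in> S \<inter> T} =
      {z. z \<noteq> 0 \<and> proj z \<in> S} \<inter> {z. z \<noteq> 0 \<and> proj z \<in> T}" by auto
  ultimately show "open (S \<inter> T)" unfolding open_cp2_def by (simp only: open_Int)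
next
  fix K :: "cp2 set set" assume "\<forall>S\<in>K. open S"
  moreover have "{z. z \<noteq> 0 \<and> proj z \<in> \<Union>K} = (\<Union>S\<in>K. {z. z \<noteq> 0 \<and> proj z \<in> S})" by auto
  ultimately show "open (\<Union>K)" unfolding open_cp2_def by (simp only: open_UN)
qed
end

definition invariant_measure :: "cp2 measure \<Rightarrow> bool" where
  "invariant_measure M \<longleftrightarrow>
     sets M = sets borel \<and> emeasure M UNIV = 1 \<and> (\<forall>g\<in>SU3. distr M M (act g) = M)"

primrec Ck :: "nat \<Rightarrow> ('a::euclidean_space \<Rightarrow> complex) \<Rightarrow> bool" where
  "Ck 0 f \<longleftrightarrow> continuous_on UNIV f"
| "Ck (Suc k) f \<longleftrightarrow>
     (\<forall>x. f differentiable (at x)) \<and> (\<forall>v. Ck k (\<lambda>x. frechet_derivative f (at x) v))"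

text \<open>Smoothness in the three standard affine charts.\<close>

definition smooth_cp2 :: "(cp2 \<Rightarrow> complex) \<Rightarrow> bool" where
  "smooth_cp2 f \<longleftrightarrow>
     (\<forall>k. Ck k (\<lambda>w :: complex ^ 2. f (proj (vector [1, w $ 1, w $ 2]))) \<and>
          Ck k (\<lambda>w :: complex ^ 2. f (proj (vector [w $ 1, 1, w $ 2]))) \<and>
          Ck k (\<lambda>w :: complex ^ 2. f (proj (vector [w $ 1, w $ 2, 1]))))"

text \<open>
  Here \<open>\<pi> n\<close> realises the irrep \<open>(n, n)\<close> with GT basis \<open>f n\<close>.
  \<open>X\<^sup>n\<^sub>\<nu>\<^sub>J(g x\<^sub>0)\<close> does not depend on the choice of \<open>g\<close>, since the
  vector with label \<open>((n, n, n), 0)\<close> is fixed by the isotropy group of \<open>x\<^sub>0\<close>.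
\<close>

definition harmonic ::
    "(nat \<Rightarrow> complex ^ 3 ^ 3 \<Rightarrow> 'v::chilbert \<Rightarrow> 'v) \<Rightarrow> (nat \<Rightarrow> nu \<times> real \<Rightarrow> 'v) \<Rightarrow>
     nat \<Rightarrow> nu \<times> real \<Rightarrow> cp2 \<Rightarrow> complex" where
  "harmonic \<pi> f n l x =
     complex_of_real ((real n + 1) powr (3 / 2)) *
     cnj (wigner (\<pi> n) (f n) l ((int n, int n, int n), 0) (SOME g. g \<in> SU3 \<and> act g base_point = x))"


section \<open>Symbol correspondences\<close>

definition symbol_correspondence ::
    "(complex ^ 3 ^ 3 \<Rightarrow> complex ^ 'd ^ 'd) \<Rightarrow> nat \<Rightarrow> nat \<Rightarrow> cp2 measure \<Rightarrow>
     (complex ^ 'd ^ 'd \<Rightarrow> cp2 \<Rightarrow> complex) \<Rightarrow> bool" where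
  "symbol_correspondence \<rho> p q M W \<longleftrightarrow>
     inj W \<and>
     (\<forall>A B. W (A + B) = (\<lambda>x. W A x + W B x)) \<and>
     (\<forall>a A. W (cscale a A) = (\<lambda>x. a * W A x)) \<and>
     (\<forall>A. smooth_cp2 (W A)) \<and>
     (\<forall>g\<in>SU3. \<forall>A. W (conj_action \<rho> g A) = (\<lambda>x. W A (act (matrix_inv g) x))) \<and>
     (\<forall>A. W (dagger A) = (\<lambda>x. cnj (W A x))) \<and>
     (\<forall>A. integral\<^sup>L M (W A) = trace A / complex_of_real (irrep_dim p q))"

definition characteristic_numbers ::
    "nat \<Rightarrow> nat \<Rightarrow> (nat \<Rightarrow> nu \<times> real \<Rightarrow> complex ^ 'd ^ 'd) \<Rightarrow>
     (nat \<Rightarrow> nu \<times> real \<Rightarrow> cp2 \<Rightarrow> complex) \<Rightarrow>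
     (complex ^ 'd ^ 'd \<Rightarrow> cp2 \<Rightarrow> complex) \<Rightarrow> (nat \<Rightarrow> real) \<Rightarrow> bool" where
  "characteristic_numbers p q E X W c \<longleftrightarrow>
     c 0 = 1 \<and> (\<forall>n\<in>{1..p + q}. c n \<noteq> 0) \<and>
     (\<forall>n\<le>p + q. \<forall>l\<in>gt_labels n n.
        W (sqrt (irrep_dim p q) *\<^sub>R E n l) = (\<lambda>x. complex_of_real (c n) * X n l x))"

text \<open>Only meaningful for \<open>f\<close> and \<open>h\<close> in the range of \<open>W\<close>.\<close>

definition twisted_product ::
    "(complex ^ 'd ^ 'd \<Rightarrow> cp2 \<Rightarrow> complex) \<Rightarrow> (cp2 \<Rightarrow> complex) \<Rightarrow> (cp2 \<Rightarrow> complex) \<Rightarrow>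
     cp2 \<Rightarrow> complex" where
  "twisted_product W f h = W (inv W f ** inv W h)"

end

theory Submission
  imports Defs
begin

text \<open>
  The coupled basis is orthonormal and \<open>W\<close> is injective and linear, so everything rests on the
  matrix elements \<open>\<langle>E, E\<^sub>1 E\<^sub>2\<rangle>\<close>. A real Clebsch-Gordan coefficient is, up to the sign coming from
  the induced dual basis, the matrix entry of a coupled operator in the GT basis. Multiplying two
  operators and taking the trace form with a third therefore turns into the triple sum of the
  Wigner product symbol.

  Conjugation acts by algebra automorphisms, so the derived representation acts by derivations,
  with \<open>U\<^sub>+\<close> the adjoint of \<open>U\<^sub>-\<close>. The Cartan elements give additivity of the weights. If a
  matrix element of three \<open>U\<close>-spin multiplets is nonzero and one of the three weights is below its
  maximum, the Leibniz rule for \<open>U\<^sub>\<plusminus>\<close> yields another nonzero one with this weight raised by 1. So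
  each weight can be raised to its top, where additivity and the bounds on the other two weights
  are one of the three triangle inequalities.
\<close>

section \<open>Inner products, matrix exponentials and derived representations\<close>

lemma cinner_add_left: "cinner (x + y) z = cinner x z + cinner y z"
  by (metis cinner_add_right cinner_commute complex_cnj_add)

lemma cinner_cscale_left: "cinner (cscale a x) y = cnj a * cinner x y"
  by (metis cinner_cscale_right cinner_commute complex_cnj_mult)

lemma cinner_scaleR_left: "cinner (r *\<^sub>R x) y = of_real r * cinner x y"
  by (metis cinner_cscale_left cscale_of_real complex_cnj_complex_of_real)

lemma cinner_scaleR_right: "cinner x (r *\<^sub>R y) = of_real r * cinner x y"
  by (metis cinner_cscale_right cscale_of_real)

text \<open>Conjugate-linearity in the first entry is still real linearity, and in finite dimension
  every real bilinear map is bounded. This makes the product rule for derivatives available.\<close>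

lemma bounded_bilinear_cinner: "bounded_bilinear (cinner :: 'v::chilbert \<Rightarrow> 'v \<Rightarrow> complex)"
  unfolding bilinear_conv_bounded_bilinear[symmetric] bilinear_def
  by (auto intro!: linearI simp: cinner_add_left cinner_add_right cinner_scaleR_left
      cinner_scaleR_right scaleR_conv_of_real)

interpretation cinner: bounded_bilinear "cinner :: 'v::chilbert \<Rightarrow> 'v \<Rightarrow> complex"
  by (rule bounded_bilinear_cinner)

interpretation matmul: bounded_bilinear
    "(**) :: complex ^ 'm ^ 'n \<Rightarrow> complex ^ 'k ^ 'm \<Rightarrow> complex ^ 'k ^ 'n"
  unfolding bilinear_conv_bounded_bilinear[symmetric] bilinear_def
  by (auto intro!: linearI simp: matrix_matrix_mult_def vec_eq_iff scaleR_sum_right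
      algebra_simps sum.distrib)

lemma cscale_mult_left: "cscale a A ** B = cscale a (A ** B)"
  for A :: "complex ^ 'm ^ 'n"
  by (simp add: matrix_matrix_mult_def vec_eq_iff cscale_vec_def cscale_complex_def
      sum_distrib_left mult.assoc)

lemma cscale_mult_right: "A ** cscale a B = cscale a (A ** B)"
  for A :: "complex ^ 'm ^ 'n"
  by (simp add: matrix_matrix_mult_def vec_eq_iff cscale_vec_def cscale_complex_def
      sum_distrib_left mult.left_commute)

lemma dagger_mult: "dagger (A ** B) = dagger B ** dagger A"
  by (simp add: dagger_def matrix_matrix_mult_def vec_eq_iff mult.commute)

lemma linear_dagger: "linear dagger"
  by (rule linearI) (simp_all add: dagger_def vec_eq_iff)

section \<open>The matrix exponential\<close>

definition mpow :: "complex ^ 3 ^ 3 \<Rightarrow> nat \<Rightarrow> complex ^ 3 ^ 3" where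
  "mpow A k = ((\<lambda>B. A ** B) ^^ k) (mat 1)"

lemma mpow_0 [simp]: "mpow A 0 = mat 1"
  and mpow_Suc [simp]: "mpow A (Suc k) = A ** mpow A k"
  by (simp_all add: mpow_def)

lemma mpow_scaleR: "mpow (t *\<^sub>R A) k = t ^ k *\<^sub>R mpow A k"
  by (induction k) (simp_all add: matmul.scaleR_left matmul.scaleR_right)

lemma mexp_scaleR: "mexp (t *\<^sub>R A) = (\<Sum>k. (t ^ k / fact k) *\<^sub>R mpow A k)"
  by (simp add: mexp_def mpow_def[symmetric] mpow_scaleR)

text \<open>\<open>K\<close> is a bound for the linear map of left multiplication by
  \<open>A\<close>, and each further factor \<open>A\<close> contributes one \<open>K\<close>. The
  estimate lets a scalar exponential series dominate that of the matrix.\<close>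

lemma mpow_bound: obtains K where "0 < K" "\<And>k. norm (mpow A k) \<le> K ^ k * norm (mat 1 :: complex ^ 3 ^ 3)"
proof -
  obtain K where K: "K > 0" "\<And>B :: complex ^ 3 ^ 3. norm (A ** B) \<le> norm B * K"
    using bounded_linear.pos_bounded[OF matmul.bounded_linear_right[of A]] by blast
  have "norm (mpow A k) \<le> K ^ k * norm (mat 1 :: complex ^ 3 ^ 3)" for k
  proof (induction k)
    case (Suc k)
    have "norm (mpow A (Suc k)) \<le> norm (mpow A k) * K" using K(2)[of "mpow A k"] by simp
    also have "\<dots> \<le> (K ^ k * norm (mat 1 :: complex ^ 3 ^ 3)) * K"
      using Suc K by (intro mult_right_mono) auto
    finally show ?case by (simp add: mult_ac)
  qed simp
  then show thesis using K that by blast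
qed

lemma summable_mexp: "summable (\<lambda>k. (t ^ k / fact k) *\<^sub>R mpow A k)"
proof -
  obtain K where K: "K > 0" "\<And>k. norm (mpow A k) \<le> K ^ k * norm (mat 1 :: complex ^ 3 ^ 3)"
    using mpow_bound by blast
  show ?thesis
  proof (rule summable_comparison_test')
    show "summable (\<lambda>k. (inverse (fact k) * (\<bar>t\<bar> * K) ^ k) * norm (mat 1 :: complex ^ 3 ^ 3))"
      by (intro summable_mult2 summable_exp)
    fix k
    show "norm ((t ^ k / fact k) *\<^sub>R mpow A k)
        \<le> (inverse (fact k) * (\<bar>t\<bar> * K) ^ k) * norm (mat 1 :: complex ^ 3 ^ 3)"
      using mult_left_mono[OF K(2)[of k], of "\<bar>t\<bar> ^ k / fact k"]
      by (simp add: power_abs power_mult_distrib field_simps)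
  qed
qed

text \<open>Against each basis vector \<open>b\<close> the series becomes a scalar power series in
  \<open>t\<close> that converges everywhere, so it may be differentiated termwise.\<close>

lemma mexp_has_vector_derivative:
  "((\<lambda>t. mexp (t *\<^sub>R A)) has_vector_derivative A ** mexp (t *\<^sub>R A)) (at t)"
  unfolding has_vector_derivative_def
proof (subst has_derivative_componentwise_within, rule ballI)
  fix b :: "complex ^ 3 ^ 3" assume "b \<in> Basis"
  define c where "c = (\<lambda>k. (mpow A k \<bullet> b) / fact k)"
  have eq: "(t ^ k / fact k) *\<^sub>R mpow A k \<bullet> b = c k * t ^ k" for k t
    by (simp add: c_def)
  have summ: "summable (\<lambda>k. c k * t ^ k)" for t
    using bounded_linear.summable[OF bounded_linear_inner_left[of b] summable_mexp[of t A]]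
    by (simp only: eq)
  have val: "mexp (t *\<^sub>R A) \<bullet> b = (\<Sum>k. c k * t ^ k)" for t
    using bounded_linear.suminf[OF bounded_linear_inner_left[of b] summable_mexp[of t A]]
    by (simp only: eq mexp_scaleR)
  \<comment> \<open>In \<open>diffs\<close> the factor k + 1 turns 1 / fact (k + 1) into 1 / fact k,
    while the power k + 1 of \<open>A\<close> is \<open>A ** mpow A k\<close>.\<close>
  have eq': "(A ** ((t ^ k / fact k) *\<^sub>R mpow A k)) \<bullet> b = diffs c k * t ^ k" for k
    by (simp add: c_def diffs_def matmul.scaleR_right)
  have "A ** mexp (t *\<^sub>R A) = (\<Sum>k. A ** ((t ^ k / fact k) *\<^sub>R mpow A k))"
    unfolding mexp_scaleR
    by (rule bounded_linear.suminf[OF matmul.bounded_linear_right summable_mexp])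
  moreover have "summable (\<lambda>k. A ** ((t ^ k / fact k) *\<^sub>R mpow A k))"
    by (rule bounded_linear.summable[OF matmul.bounded_linear_right summable_mexp])
  ultimately have val': "(A ** mexp (t *\<^sub>R A)) \<bullet> b = (\<Sum>k. diffs c k * t ^ k)"
    using bounded_linear.suminf[OF bounded_linear_inner_left[of b]] by (simp only: eq')
  have "((\<lambda>t. mexp (t *\<^sub>R A) \<bullet> b) has_real_derivative (A ** mexp (t *\<^sub>R A)) \<bullet> b) (at t)"
    unfolding val val' by (rule termdiffs_strong_converges_everywhere[OF summ])
  then show "((\<lambda>t. mexp (t *\<^sub>R A) \<bullet> b) has_derivative
      (\<lambda>h. (h *\<^sub>R (A ** mexp (t *\<^sub>R A))) \<bullet> b)) (at t within UNIV)"
    by (simp add: has_field_derivative_def mult_commute_abs)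
qed

lemma mexp_0 [simp]: "mexp 0 = mat 1"
proof -
  have "mexp (0 *\<^sub>R 0) = (\<Sum>k\<in>{0}. (0 ^ k / fact k) *\<^sub>R mpow 0 k)"
    unfolding mexp_scaleR by (rule suminf_finite) auto
  then show ?thesis by simp
qed

section \<open>Derived representations of su(3) and sl(3,C)\<close>

definition su3 :: "(complex ^ 3 ^ 3) set" where
  "su3 = {X. dagger X = - X \<and> trace X = 0}"

lemma constant_if_zero_derivative:
  fixes f :: "real \<Rightarrow> 'a::real_normed_vector"
  assumes "\<And>t. (f has_vector_derivative 0) (at t)"
  shows "f s = f t"
  by (rule has_derivative_zero_unique[of UNIV])
     (use assms in \<open>auto simp: has_vector_derivative_def\<close>)

lemma bounded_linear_entry: "bounded_linear (\<lambda>A :: complex ^ 'm ^ 'n. A $ i $ j)"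
  by (rule bounded_linear_compose[OF bounded_linear_vec_nth bounded_linear_vec_nth])

text \<open>Both defining conditions of \<open>SU3\<close> are constant along the curve: the
  derivative of \<open>dagger (\<phi> t) ** \<phi> t\<close> cancels because \<open>X\<close> is
  skew-Hermitian, and that of the determinant has the trace of \<open>X\<close> as a factor.\<close>

lemma mexp_in_SU3:
  assumes "X \<in> su3"
  shows "mexp (t *\<^sub>R X) \<in> SU3"
proof -
  define \<phi> where "\<phi> t = mexp (t *\<^sub>R X)" for t
  have X: "dagger X = - X" "X $ 1 $ 1 + X $ 2 $ 2 + X $ 3 $ 3 = 0"
    using assms by (simp_all add: su3_def trace_def sum_3)
  have \<phi>0: "\<phi> 0 = mat 1" by (simp add: \<phi>_def)
  have d: "(\<phi> has_vector_derivative X ** \<phi> t) (at t)" for t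
    unfolding \<phi>_def by (rule mexp_has_vector_derivative)
  have "((\<lambda>t. dagger (\<phi> t)) has_vector_derivative dagger (X ** \<phi> t)) (at t)" for t
    using bounded_linear.has_vector_derivative[OF linear_conv_bounded_linear[THEN iffD1, OF linear_dagger] d] .
  then have "((\<lambda>t. dagger (\<phi> t) ** \<phi> t) has_vector_derivative 0) (at t)" for t
    using matmul.has_vector_derivative[OF _ d, of "\<lambda>t. dagger (\<phi> t)" "dagger (X ** \<phi> t)" t]
    by (simp add: dagger_mult X matrix_mul_assoc matmul.minus_right matmul.minus_left)
  from constant_if_zero_derivative[of "\<lambda>t. dagger (\<phi> t) ** \<phi> t", OF this]
  have "dagger (\<phi> t) ** \<phi> t = dagger (\<phi> 0) ** \<phi> 0" .
  also have "\<dots> = mat 1" 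
  proof -
    have "dagger (mat 1) = (mat 1 :: complex ^ 3 ^ 3)"
      by (auto simp: dagger_def vec_eq_iff mat_def)
    then show ?thesis by (simp add: \<phi>0)
  qed
  finally have unitary: "dagger (\<phi> t) ** \<phi> t = mat 1" .
  have de: "((\<lambda>t. \<phi> t $ i $ j) has_vector_derivative (X ** \<phi> t) $ i $ j) (at t)" for t i j
    using bounded_linear.has_vector_derivative[OF bounded_linear_entry d] .
  \<comment> \<open>Liouville's formula, read off from the explicit 3 by 3 determinant.\<close>
  have "((\<lambda>t. det (\<phi> t)) has_vector_derivative (X $ 1 $ 1 + X $ 2 $ 2 + X $ 3 $ 3) * det (\<phi> t)) (at t)" for t
    unfolding det_3
    by (rule derivative_eq_intros de refl)+
       (simp add: matrix_matrix_mult_def sum_3 algebra_simps)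
  then have "((\<lambda>t. det (\<phi> t)) has_vector_derivative 0) (at t)" for t by (simp add: X)
  from constant_if_zero_derivative[of "\<lambda>t. det (\<phi> t)", OF this] have "det (\<phi> t) = det (\<phi> 0)" .
  then have "det (\<phi> t) = 1" by (simp add: \<phi>0)
  with unitary show ?thesis by (simp add: SU3_def \<phi>_def)
qed

text \<open>\<open>unitary_rep\<close> gives differentiability only within \<open>SU3\<close>, so
  the chain rule rests on the exponential curve staying in \<open>SU3\<close>.\<close>

lemma lie_su_has_vector_derivative:
  assumes "unitary_rep R" "X \<in> su3"
  shows "((\<lambda>t. R (mexp (t *\<^sub>R X)) v) has_vector_derivative lie_su R X v) (at 0)"
proof -
  define \<phi> where "\<phi> t = mexp (t *\<^sub>R X)" for t
  have im: "\<phi> ` UNIV \<subseteq> SU3" using mexp_in_SU3[OF assms(2)] by (auto simp: \<phi>_def)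
  have "\<phi> differentiable (at 0)"
    using mexp_has_vector_derivative[of X 0] unfolding \<phi>_def by (rule differentiableI_vector)
  moreover have "(\<lambda>g. R g v) differentiable (at (\<phi> 0) within SU3)"
  proof -
    have "(\<lambda>g. R g v) differentiable_on SU3" using assms(1) by (simp add: unitary_rep_def)
    moreover have "\<phi> 0 \<in> SU3" using im by blast
    ultimately show ?thesis unfolding differentiable_on_def by blast
  qed
  then have "(\<lambda>g. R g v) differentiable (at (\<phi> 0) within range \<phi>)"
    by (rule differentiable_within_subset) (use im in auto)
  ultimately have "((\<lambda>g. R g v) \<circ> \<phi>) differentiable (at 0)"
    by (intro differentiable_chain_within) auto
  then show ?thesis
    unfolding lie_su_def by (simp add: vector_derivative_works \<phi>_def o_def)
qed

lemma lie_su_eqI: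
  assumes "((\<lambda>t. R (mexp (t *\<^sub>R X)) v) has_vector_derivative w) (at 0)"
  shows "lie_su R X v = w"
  unfolding lie_su_def using assms by (rule vector_derivative_at)

text \<open>The curve of \<open>- X\<close> is that of \<open>X\<close> run backwards. This serves
  \<open>dagger Z\<close>, whose skew-Hermitian part is the negative of that of
  \<open>Z\<close>.\<close>

lemma lie_su_minus:
  assumes "unitary_rep R" "X \<in> su3"
  shows "lie_su R (- X) v = - lie_su R X v"
proof (rule lie_su_eqI)
  have "((\<lambda>t. R (mexp (t *\<^sub>R X)) v) has_vector_derivative lie_su R X v) (at (- 0))"
    using lie_su_has_vector_derivative[OF assms] by simp
  then have "((\<lambda>t. R (mexp (t *\<^sub>R X)) v) \<circ> uminus has_vector_derivative (-1) *\<^sub>R lie_su R X v) (at 0)"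
    by (intro vector_diff_chain_at) (auto intro!: derivative_eq_intros)
  then show "((\<lambda>t. R (mexp (t *\<^sub>R - X)) v) has_vector_derivative - lie_su R X v) (at 0)"
    by (simp add: o_def)
qed

text \<open>By unitarity the pairing of the two moving vectors is constant; its derivative at 0
  vanishes and splits by the product rule.\<close>

lemma lie_su_skew:
  assumes "unitary_rep R" "X \<in> su3"
  shows "cinner (lie_su R X v) w = - cinner v (lie_su R X w)"
proof -
  have 1: "R (mat 1) = id" using assms(1) by (simp add: unitary_rep_def)
  have "((\<lambda>t. cinner (R (mexp (t *\<^sub>R X)) v) (R (mexp (t *\<^sub>R X)) w)) has_vector_derivative
      cinner v (lie_su R X w) + cinner (lie_su R X v) w) (at 0)"
    using cinner.has_vector_derivative[OF lie_su_has_vector_derivative[OF assms, of v]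
        lie_su_has_vector_derivative[OF assms, of w]] by (simp add: 1)
  moreover have "(\<lambda>t. cinner (R (mexp (t *\<^sub>R X)) v) (R (mexp (t *\<^sub>R X)) w)) = (\<lambda>t. cinner v w)"
    using assms(1) mexp_in_SU3[OF assms(2)] by (simp add: unitary_rep_def)
  ultimately have "cinner v (lie_su R X w) + cinner (lie_su R X v) w = 0"
    by (metis has_vector_derivative_const vector_derivative_at)
  then show ?thesis by (simp add: eq_neg_iff_add_eq_0 add.commute)
qed

lemma trace_dagger: "trace (dagger A) = cnj (trace A)"
  by (simp add: trace_def dagger_def)

lemma skew_parts_in_su3:
  assumes "trace Z = 0"
  shows "cscale (1 / 2) (Z - dagger Z) \<in> su3"
    and "cscale (- \<i> / 2) (Z + dagger Z) \<in> su3"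
proof -
  have "trace (cscale a A) = a * trace A" for a and A :: "complex ^ 3 ^ 3"
    by (simp add: trace_def cscale_vec_def cscale_complex_def sum_distrib_left)
  then show "cscale (1 / 2) (Z - dagger Z) \<in> su3" "cscale (- \<i> / 2) (Z + dagger Z) \<in> su3"
    using assms
    by (simp_all add: su3_def trace_sub trace_add trace_dagger)
       (simp_all add: dagger_def cscale_vec_def cscale_complex_def vec_eq_iff field_simps)
qed

text \<open>Write Z = X + i Y with \<open>X\<close> and \<open>Y\<close> in su(3); then
  \<open>dagger Z\<close> is - X + i Y. Both parts act as skew operators, and conjugating i reverses
  the sign of the second part once more.\<close>

lemma lie_sl_adjoint:
  assumes "unitary_rep R" "trace Z = 0"
  shows "cinner (lie_sl R Z v) w = cinner v (lie_sl R (dagger Z) w)"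
proof -
  define X Y where "X = cscale (1 / 2) (Z - dagger Z)" and "Y = cscale (- \<i> / 2) (Z + dagger Z)"
  have su: "X \<in> su3" "Y \<in> su3"
    using skew_parts_in_su3[OF assms(2)] by (simp_all add: X_def Y_def)
  have dd: "dagger (dagger Z) = Z" by (simp add: dagger_def vec_eq_iff)
  have X: "cscale (1 / 2) (dagger Z - Z) = - X"
    by (simp add: X_def cscale_vec_def cscale_complex_def vec_eq_iff field_simps)
  have Y: "cscale (- \<i> / 2) (dagger Z + Z) = Y"
    by (simp add: Y_def add.commute)
  show ?thesis
    unfolding lie_sl_def dd X Y X_def[symmetric] Y_def[symmetric] lie_su_minus[OF assms(1) su(1)]
    by (simp add: cinner_add_left cinner_cscale_left cinner_add_right cinner_cscale_right
        lie_su_skew[OF assms(1) su(1)] lie_su_skew[OF assms(1) su(2)] cinner.minus_right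
        cinner.diff_right)
qed

text \<open>Conjugation is multiplicative, since \<open>\<rho> g\<close> and its inverse cancel
  between the factors; differentiating at the identity gives the Leibniz rule.\<close>

lemma lie_su_conj_action_mult:
  fixes \<rho> :: "complex ^ 3 ^ 3 \<Rightarrow> complex ^ 'd ^ 'd"
  assumes R: "unitary_rep (conj_action \<rho>)" and X: "X \<in> su3"
    and inv: "\<And>g. g \<in> SU3 \<Longrightarrow> invertible (\<rho> g)"
  shows "lie_su (conj_action \<rho>) X (A ** B) =
    lie_su (conj_action \<rho>) X A ** B + A ** lie_su (conj_action \<rho>) X B"
proof (rule lie_su_eqI)
  let ?c = "\<lambda>t. conj_action \<rho> (mexp (t *\<^sub>R X))"
  have 1: "conj_action \<rho> (mat 1) = id" using R by (simp add: unitary_rep_def)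
  have mult: "conj_action \<rho> g (A ** B) = conj_action \<rho> g A ** conj_action \<rho> g B"
    if "g \<in> SU3" for g
  proof -
    \<comment> \<open>\<open>matrix_inv\<close> is defined by choice, and invertibility makes the
      chosen matrix an actual inverse.\<close>
    have "A ** B = A ** (matrix_inv (\<rho> g) ** \<rho> g) ** B"
      using someI_ex[OF inv[OF that, unfolded invertible_def], folded matrix_inv_def] by simp
    then show ?thesis by (simp add: conj_action_def matrix_mul_assoc)
  qed
  have "((\<lambda>t. ?c t A ** ?c t B) has_vector_derivative
      lie_su (conj_action \<rho>) X A ** B + A ** lie_su (conj_action \<rho>) X B) (at 0)"
    using matmul.has_vector_derivative[OF lie_su_has_vector_derivative[OF R X, of A]
        lie_su_has_vector_derivative[OF R X, of B]] by (simp add: 1 add.commute)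
  then show "((\<lambda>t. ?c t (A ** B)) has_vector_derivative
      lie_su (conj_action \<rho>) X A ** B + A ** lie_su (conj_action \<rho>) X B) (at 0)"
    by (simp add: mult mexp_in_SU3[OF X])
qed

lemma lie_sl_conj_action_mult:
  fixes \<rho> :: "complex ^ 3 ^ 3 \<Rightarrow> complex ^ 'd ^ 'd"
  assumes R: "unitary_rep (conj_action \<rho>)" and Z: "trace Z = 0"
    and inv: "\<And>g. g \<in> SU3 \<Longrightarrow> invertible (\<rho> g)"
  shows "lie_sl (conj_action \<rho>) Z (A ** B) =
    lie_sl (conj_action \<rho>) Z A ** B + A ** lie_sl (conj_action \<rho>) Z B"
proof -
  have "lie_su (conj_action \<rho>) X (A ** B) =
      lie_su (conj_action \<rho>) X A ** B + A ** lie_su (conj_action \<rho>) X B" if "X \<in> su3" for X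
    using R that inv by (rule lie_su_conj_action_mult)
  note d = this[OF skew_parts_in_su3(1)[OF Z]] this[OF skew_parts_in_su3(2)[OF Z]]
  show ?thesis
    unfolding lie_sl_def d
    by (simp only: matmul.add_left matmul.add_right cscale_add_right cscale_mult_left
        cscale_mult_right ac_simps)
qed

section \<open>Orthonormal bases and the Wigner product symbol\<close>

lemma cscale_0 [simp]: "cscale 0 x = 0"
  using cscale_of_real[of 0 x] by simp

lemma cscale_1 [simp]: "cscale 1 x = x"
  using cscale_of_real[of 1 x] by simp

text \<open>Replaces the unspecified coefficients in a span condition, such as the one of
  \<open>gt_basis\<close>, by inner products.\<close>

lemma orthonormal_expansion:
  assumes I: "finite I"
    and on: "\<And>i j. i \<in> I \<Longrightarrow> j \<in> I \<Longrightarrow> cinner (b i) (b j) = (if i = j then 1 else 0)"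
    and x: "x = (\<Sum>i\<in>I. cscale (a i) (b i))"
  shows "x = (\<Sum>i\<in>I. cscale (cinner (b i) x) (b i))"
proof -
  have "cinner (b j) x = a j" if "j \<in> I" for j
  proof -
    have "cinner (b j) x = (\<Sum>i\<in>I. a i * cinner (b j) (b i))"
      unfolding x by (simp add: cinner.sum_right cinner_cscale_right)
    also have "\<dots> = (\<Sum>i\<in>I. if i = j then a i else 0)"
      using that by (intro sum.cong) (auto simp: on)
    finally show ?thesis using I that by simp
  qed
  then show ?thesis by (subst x) simp
qed

lemma orthonormal_parseval:
  assumes "\<And>x. x = (\<Sum>i\<in>I. cscale (cinner (b i) x) (b i))"
  shows "(\<Sum>i\<in>I. cinner x (b i) * cinner (b i) y) = cinner x y"
proof -
  have "cinner x y = cinner x (\<Sum>i\<in>I. cscale (cinner (b i) y) (b i))"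
    using assms[of y] by simp
  then show ?thesis by (simp add: cinner.sum_right cinner_cscale_right mult.commute)
qed

lemma cinner_matrix_vector:
  fixes A :: "complex ^ 'd ^ 'd"
  shows "cinner x (A *v y) = cinner (dagger A *v x) y"
proof -
  have "cinner x (A *v y) = (\<Sum>i\<in>UNIV. \<Sum>j\<in>UNIV. cnj (x $ i) * A $ i $ j * y $ j)"
    by (simp add: cinner_vec_def cinner_complex_def matrix_vector_mult_def sum_distrib_left mult.assoc)
  also have "\<dots> = (\<Sum>j\<in>UNIV. \<Sum>i\<in>UNIV. cnj (x $ i) * A $ i $ j * y $ j)"
    by (rule sum.swap)
  also have "\<dots> = cinner (dagger A *v x) y"
    by (simp add: cinner_vec_def cinner_complex_def matrix_vector_mult_def dagger_def
        sum_distrib_left mult_ac)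
  finally show ?thesis .
qed

text \<open>Each entry of \<open>A *v x\<close> is the inner product of a conjugated row of
  \<open>A\<close> with \<open>x\<close>. Parseval, applied row by row, evaluates the trace form in
  the given basis.\<close>

lemma orthonormal_trace:
  fixes C D :: "complex ^ 'd ^ 'd"
  assumes "\<And>x. x = (\<Sum>i\<in>I. cscale (cinner (b i) x) (b i))"
  shows "(\<Sum>i\<in>I. cinner (C *v b i) (D *v b i)) = cinner C D"
proof -
  have row: "(A *v x) $ k = cinner (dual_vec (A $ k)) x" for A :: "complex ^ 'd ^ 'd" and x k
    by (simp add: cinner_vec_def cinner_complex_def matrix_vector_mult_def dual_vec_def)
  have "(\<Sum>i\<in>I. cinner (C *v b i) (D *v b i)) =
      (\<Sum>i\<in>I. \<Sum>k\<in>UNIV. cinner (dual_vec (D $ k)) (b i) * cinner (b i) (dual_vec (C $ k)))"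
    unfolding cinner_vec_def[of "C *v _"] cinner_complex_def row cinner_commute[symmetric]
    by (simp add: mult.commute)
  also have "\<dots> = (\<Sum>k\<in>UNIV. cinner (dual_vec (D $ k)) (dual_vec (C $ k)))"
    by (subst sum.swap) (simp add: orthonormal_parseval[OF assms])
  also have "\<dots> = cinner C D"
    by (simp add: cinner_vec_def cinner_complex_def dual_vec_def mult.commute)
  finally show ?thesis .
qed

section \<open>Gelfand-Tsetlin labels and duality\<close>

lemma mem_gt_labels_iff:
  "((\<nu>1, \<nu>2, \<nu>3), J) \<in> gt_labels p q \<longleftrightarrow>
    (\<exists>r s :: int. 0 \<le> r \<and> r \<le> int q \<and> int q \<le> s \<and> s \<le> int p + int q \<and> r \<le> \<nu>3 \<and> \<nu>3 \<le> s \<and>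
      \<nu>1 = int p + 2 * int q - (s + r) \<and> \<nu>2 = s + r - \<nu>3 \<and>
      J = (real_of_int s - real_of_int r) / 2)"
  by (auto simp: gt_labels_def)

lemma finite_gt_labels: "finite (gt_labels p q)"
proof (rule finite_subset)
  let ?h = "\<lambda>(r, s, v). ((int p + 2 * int q - (s + r), s + r - v, v),
    (real_of_int s - real_of_int r) / 2)"
  show "gt_labels p q \<subseteq> ?h ` ({0..int q} \<times> {0..int p + int q} \<times> {0..int p + int q})"
  proof
    fix l assume "l \<in> gt_labels p q"
    then obtain r s v where "l = ?h (r, s, v)" "0 \<le> r" "r \<le> int q" "int q \<le> s"
      "s \<le> int p + int q" "r \<le> v" "v \<le> s"
      unfolding gt_labels_def by auto
    then show "l \<in> ?h ` ({0..int q} \<times> {0..int p + int q} \<times> {0..int p + int q})"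
      by (intro image_eqI[where x = "(r, s, v)"]) auto
  qed
qed simp

lemma check_check [simp]: "check s (check s \<nu>) = \<nu>"
  by (cases \<nu>) simp

lemma tu2_check [simp]: "tu2 (check s \<nu>) = - tu2 \<nu>"
  by (cases \<nu>) simp

text \<open>Duality reflects the interval from r to s into the one from p + q - s to p + q - r. Its
  length, and with it \<open>J\<close>, is unchanged.\<close>

lemma check_in_gt_labels:
  assumes "(\<nu>, J) \<in> gt_labels q p"
  shows "(check (p + q) \<nu>, J) \<in> gt_labels p q"
proof -
  obtain \<nu>1 \<nu>2 \<nu>3 where \<nu>: "\<nu> = (\<nu>1, \<nu>2, \<nu>3)" by (cases \<nu>)
  obtain r s where "0 \<le> r" "r \<le> int p" "int p \<le> s" "s \<le> int q + int p"
    "r \<le> \<nu>3" "\<nu>3 \<le> s" "\<nu>1 = int q + 2 * int p - (s + r)" "\<nu>2 = s + r - \<nu>3"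
    "J = (real_of_int s - real_of_int r) / 2"
    using assms unfolding \<nu> mem_gt_labels_iff by blast
  then show ?thesis
    unfolding \<nu> check.simps mem_gt_labels_iff
    by (intro exI[of _ "int (p + q) - s"] exI[of _ "int (p + q) - r"]) auto
qed

lemma sum_check_gt_labels:
  "(\<Sum>(\<mu>, K)\<in>gt_labels q p. F (check (p + q) \<mu>, K)) = (\<Sum>l\<in>gt_labels p q. F l)"
  by (rule sum.reindex_bij_witness[where i = "\<lambda>(\<mu>, K). (check (p + q) \<mu>, K)"
        and j = "\<lambda>(\<mu>, K). (check (p + q) \<mu>, K)"])
     (auto simp: check_in_gt_labels check_in_gt_labels[of _ _ p q, unfolded add.commute[of q p]]
      simp del: check.simps)

section \<open>Clebsch-Gordan coefficients and the product symbol\<close>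

lemma minus_one_powi: "(-1) powi k = (if even k then 1 else - 1 :: complex)"
  by (simp add: power_int_minus_left)

text \<open>Pairing an operator with a rank-one tensor gives the conjugate of its matrix entry,
  times the sign of the induced dual basis. That sign is real, so reality of the coefficient removes
  the conjugation.\<close>

lemma cg_real_eq:
  assumes "cg s e E n l1 (\<mu>, K) l \<in> \<real>"
  shows "cg s e E n l1 (\<mu>, K) l =
    (-1) powi tu2 \<mu> * cinner (e l1) (E n l *v e (check s \<mu>, K))"
proof -
  let ?\<sigma> = "(-1) powi tu2 \<mu> :: complex"
  have "cinner A (tensor_op x (cscale c (dual_vec y))) = c * cnj (cinner x (A *v y))"
    for A :: "complex ^ 'd ^ 'd" and x y :: "complex ^ 'd" and c
    by (simp add: cinner_vec_def cinner_complex_def tensor_op_def dual_vec_def cscale_vec_def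
        cscale_complex_def matrix_vector_mult_def sum_distrib_left mult_ac)
  from this[of "E n l" "e l1" ?\<sigma> "e (check s \<mu>, K)"]
  have "cg s e E n l1 (\<mu>, K) l = ?\<sigma> * cnj (cinner (e l1) (E n l *v e (check s \<mu>, K)))"
    unfolding cg_def dual_gt.simps tu2_check minus_one_powi even_minus .
  moreover have "cnj ?\<sigma> = ?\<sigma>" by (simp add: minus_one_powi)
  ultimately show ?thesis
    using assms by (metis Reals_cnj_iff complex_cnj_cnj complex_cnj_mult)
qed

text \<open>The triple sum is the trace of \<open>dagger C ** A ** B\<close> written in entries,
  with \<open>A\<close>, \<open>B\<close>, \<open>C\<close> the three coupled operators. The two
  uses of \<open>check (2 * n)\<close>, in the argument here and inside the symbol, cancel.\<close>

lemma wigner_product_symbol_eq_cinner: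
  fixes e :: "nu \<times> real \<Rightarrow> complex ^ 'd"
  assumes exp: "\<And>x. x = (\<Sum>l\<in>gt_labels p q. cscale (cinner (e l) x) (e l))"
    and real: "\<And>m l k k'. (m, l) \<in> {(n1, l1), (n2, l2), (n, (\<nu>, J))} \<Longrightarrow>
      k \<in> gt_labels p q \<Longrightarrow> k' \<in> gt_labels q p \<Longrightarrow> cg (p + q) e E m k k' l \<in> \<real>"
  shows "(-1) powi (int (p + q) + tu2 \<nu>) *
      wigner_product_symbol p q e E n1 n2 n l1 l2 (check (2 * n) \<nu>, J) =
    cinner (E n (\<nu>, J)) (E n1 l1 ** E n2 l2)"
proof -
  let ?L = "gt_labels p q" and ?L' = "gt_labels q p"
  let ?A = "E n1 l1" and ?B = "E n2 l2" and ?C = "E n (\<nu>, J)"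
  define F where "F k1 k2 k3 = cinner (e k1) (?A *v e k2) * cinner (e k2) (?B *v e k3) *
    cnj (cinner (e k1) (?C *v e k3))" for k1 k2 k3
  define \<sigma> :: "int \<Rightarrow> complex" where "\<sigma> k = (-1) powi k" for k
  have \<sigma>: "\<sigma> (i + j) = \<sigma> i * \<sigma> j" "\<sigma> (- i) = \<sigma> i" "\<sigma> i * \<sigma> i = 1" "\<sigma> i * (\<sigma> i * z) = z"
    "cnj (\<sigma> i) = \<sigma> i" "\<sigma> (i - j) = \<sigma> i * \<sigma> j" for i j z
    by (auto simp: \<sigma>_def minus_one_powi)
  \<comment> \<open>All signs cancel: the prefactor and the exponent of the symbol leave the parity
    of \<open>tu2 \<mu>2\<close>, which the first coefficient removes, and the other two
    coefficients contribute \<open>tu2 \<mu>3\<close> twice.\<close>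
  have summand: "\<sigma> (int (p + q) + tu2 \<nu>) * (\<sigma> (int (p + q) + tu2 (check (2 * n) \<nu>) + tu2 \<mu>2) *
       cg (p + q) e E n1 (\<mu>1, K1) (\<mu>2, K2) l1 *
       cg (p + q) e E n2 (check (p + q) \<mu>2, K2) (\<mu>3, K3) l2 *
       cg (p + q) e E n (\<mu>1, K1) (\<mu>3, K3) (check (2 * n) (check (2 * n) \<nu>), J)) =
      F (\<mu>1, K1) (check (p + q) \<mu>2, K2) (check (p + q) \<mu>3, K3)"
    if "(\<mu>1, K1) \<in> ?L" "(\<mu>2, K2) \<in> ?L'" "(\<mu>3, K3) \<in> ?L'" for \<mu>1 K1 \<mu>2 K2 \<mu>3 K3
  proof -
    have "cg (p + q) e E n1 (\<mu>1, K1) (\<mu>2, K2) l1 =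
        \<sigma> (tu2 \<mu>2) * cinner (e (\<mu>1, K1)) (?A *v e (check (p + q) \<mu>2, K2))"
      unfolding \<sigma>_def using that by (intro cg_real_eq real) auto
    moreover have "cg (p + q) e E n2 (check (p + q) \<mu>2, K2) (\<mu>3, K3) l2 =
        \<sigma> (tu2 \<mu>3) * cinner (e (check (p + q) \<mu>2, K2)) (?B *v e (check (p + q) \<mu>3, K3))"
      unfolding \<sigma>_def using that by (intro cg_real_eq real) (auto simp: check_in_gt_labels)
    \<comment> \<open>The trace form conjugates its first argument, so this coefficient is taken in
      conjugated form, which its reality permits.\<close>
    moreover have r: "cg (p + q) e E n (\<mu>1, K1) (\<mu>3, K3) (\<nu>, J) \<in> \<real>"
      using that by (intro real) auto
    then have "cg (p + q) e E n (\<mu>1, K1) (\<mu>3, K3) (\<nu>, J) =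
        \<sigma> (tu2 \<mu>3) * cnj (cinner (e (\<mu>1, K1)) (?C *v e (check (p + q) \<mu>3, K3)))"
      using cg_real_eq[OF r] unfolding \<sigma>_def[symmetric] by (metis Reals_cnj_iff \<sigma>(5) complex_cnj_mult)
    ultimately show ?thesis by (simp add: F_def \<sigma> mult_ac)
  qed
  have "(-1) powi (int (p + q) + tu2 \<nu>) *
      wigner_product_symbol p q e E n1 n2 n l1 l2 (check (2 * n) \<nu>, J) =
      (\<Sum>k1\<in>?L. \<Sum>k2\<in>?L'. \<Sum>k3\<in>?L'. F (fst k1, snd k1)
        (check (p + q) (fst k2), snd k2) (check (p + q) (fst k3), snd k3))"
    unfolding wigner_product_symbol_def \<sigma>_def[symmetric] split_def fst_conv snd_conv sum_distrib_left
    by (intro sum.cong refl summand) simp_all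
  also have "\<dots> = (\<Sum>k1\<in>?L. \<Sum>k2\<in>?L. \<Sum>k3\<in>?L. F k1 k2 k3)"
    by (simp add: sum_check_gt_labels[unfolded split_def, where F = "\<lambda>k3. F _ _ k3"]
        sum_check_gt_labels[unfolded split_def, where F = "\<lambda>k2. \<Sum>k3\<in>?L. F _ k2 k3"])
  \<comment> \<open>The intermediate index is contracted first, by Parseval; this is the matrix
    product.\<close>
  also have "\<dots> = (\<Sum>k1\<in>?L. \<Sum>k3\<in>?L. cnj (cinner (e k1) (?C *v e k3)) *
      (\<Sum>k2\<in>?L. cinner (e k1) (?A *v e k2) * cinner (e k2) (?B *v e k3)))"
    by (rule sum.cong[OF refl], subst sum.swap) (simp add: F_def sum_distrib_left mult_ac)
  also have "\<dots> = (\<Sum>k1\<in>?L. \<Sum>k3\<in>?L. cnj (cinner (e k1) (?C *v e k3)) *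
      cinner (e k1) ((?A ** ?B) *v e k3))"
    unfolding cinner_matrix_vector[of _ ?A] orthonormal_parseval[OF exp]
    by (simp add: cinner_matrix_vector[symmetric] matrix_vector_mul_assoc)
  also have "\<dots> = (\<Sum>k3\<in>?L. \<Sum>k1\<in>?L. cinner (?C *v e k3) (e k1) *
      cinner (e k1) ((?A ** ?B) *v e k3))"
    by (subst sum.swap) (simp add: cinner_commute[symmetric])
  also have "\<dots> = cinner ?C (?A ** ?B)"
    unfolding orthonormal_parseval[OF exp] by (rule orthonormal_trace[OF exp])
  finally show ?thesis .
qed

section \<open>The coupled basis under the derived representation\<close>

lemma traceless_generators:
  "trace (E_unit 2 3) = 0" "trace (E_unit 3 2) = 0"
  "trace (cscale (1 / 2) (E_unit 1 1 - E_unit 2 2)) = 0"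
  "trace (cscale (1 / 2) (E_unit 2 2 - E_unit 3 3)) = 0"
  by (simp_all add: trace_def sum_3 E_unit_def cscale_vec_def cscale_complex_def)

lemma dagger_generators:
  "dagger (E_unit i j) = E_unit j i"
  "dagger (cscale (1 / 2) (E_unit i i - E_unit j j)) = cscale (1 / 2) (E_unit i i - E_unit j j)"
  by (auto simp: dagger_def E_unit_def cscale_vec_def cscale_complex_def vec_eq_iff)

text \<open>The effect on a label of \<open>k\<close> steps of \<open>U_plus\<close> inside a U-spin
  multiplet; negative \<open>k\<close> stands for steps of \<open>U_minus\<close>.\<close>

fun u_shift :: "int \<Rightarrow> nu \<Rightarrow> nu" where
  "u_shift k (\<nu>1, \<nu>2, \<nu>3) = (\<nu>1, \<nu>2 + k, \<nu>3 - k)"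

lemma u_shift_simps [simp]:
  "u_shift j (u_shift k \<nu>) = u_shift (j + k) \<nu>" "u_shift 0 \<nu> = \<nu>"
  "u_of (u_shift k \<nu>) = u_of \<nu> + k"
  by (cases \<nu>; simp add: field_simps)+

text \<open>The two distances to the ends of the multiplet are \<open>\<nu>3 - r\<close> and
  \<open>s - \<nu>3\<close>. This carries both the bound of the weight by \<open>J\<close> and the
  integrality needed for climbing.\<close>

lemma gt_label_weights:
  assumes "(\<nu>, J) \<in> gt_labels p q"
  obtains i j :: nat where "J - u_of \<nu> = real i" "J + u_of \<nu> = real j"
proof -
  obtain \<nu>1 \<nu>2 \<nu>3 where \<nu>: "\<nu> = (\<nu>1, \<nu>2, \<nu>3)" by (cases \<nu>)
  obtain r s where "r \<le> \<nu>3" "\<nu>3 \<le> s" "\<nu>2 = s + r - \<nu>3" "J = (real_of_int s - real_of_int r) / 2"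
    using assms unfolding \<nu> mem_gt_labels_iff by blast
  then show thesis
    by (intro that[of "nat (\<nu>3 - r)" "nat (s - \<nu>3)"]) (auto simp: \<nu> field_simps)
qed

text \<open>The pair r, s stays the same, and strict inequality leaves room for
  \<open>\<nu>3\<close> to move by one.\<close>

lemma u_shift_in_gt_labels:
  assumes "(\<nu>, J) \<in> gt_labels p q"
  shows "u_of \<nu> < J \<Longrightarrow> (u_shift 1 \<nu>, J) \<in> gt_labels p q"
    and "- J < u_of \<nu> \<Longrightarrow> (u_shift (- 1) \<nu>, J) \<in> gt_labels p q"
proof -
  obtain \<nu>1 \<nu>2 \<nu>3 where \<nu>: "\<nu> = (\<nu>1, \<nu>2, \<nu>3)" by (cases \<nu>)
  obtain r s where rs: "0 \<le> r" "r \<le> int q" "int q \<le> s" "s \<le> int p + int q"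
    "r \<le> \<nu>3" "\<nu>3 \<le> s" "\<nu>1 = int p + 2 * int q - (s + r)" "\<nu>2 = s + r - \<nu>3"
    "J = (real_of_int s - real_of_int r) / 2"
    using assms unfolding \<nu> mem_gt_labels_iff by blast
  show "(u_shift 1 \<nu>, J) \<in> gt_labels p q" if "u_of \<nu> < J"
  proof -
    have "r < \<nu>3" using that rs by (simp add: \<nu> field_simps)
    then show ?thesis unfolding \<nu> u_shift.simps mem_gt_labels_iff
      using rs by (intro exI[of _ r] exI[of _ s]) auto
  qed
  show "(u_shift (- 1) \<nu>, J) \<in> gt_labels p q" if "- J < u_of \<nu>"
  proof -
    have "\<nu>3 < s" using that rs by (simp add: \<nu> field_simps)
    then show ?thesis unfolding \<nu> u_shift.simps mem_gt_labels_iff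
      using rs by (intro exI[of _ r] exI[of _ s]) auto
  qed
qed

text \<open>Since the distance to \<open>J\<close> is a natural number, unit steps land exactly on
  \<open>J\<close>.\<close>

lemma climb:
  fixes Q :: "real \<Rightarrow> bool"
  assumes "Q x" "J - x = real k" "\<And>y. Q y \<Longrightarrow> y < J \<Longrightarrow> Q (y + 1)"
  shows "Q J"
  using assms(1,2)
proof (induction k arbitrary: x)
  case (Suc k)
  then show ?case using Suc.IH[of "x + 1"] assms(3)[of x] by simp
qed simp

section \<open>The coupled basis as an orthonormal basis of operators\<close>

locale gt_coupled_basis =
  fixes \<rho> :: "complex ^ 3 ^ 3 \<Rightarrow> complex ^ 'd ^ 'd"
    and p q :: nat
    and e :: "nu \<times> real \<Rightarrow> complex ^ 'd"
    and E :: "nat \<Rightarrow> nu \<times> real \<Rightarrow> complex ^ 'd ^ 'd"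
  assumes gt_basis_e: "gt_basis (\<lambda>g v. \<rho> g *v v) UNIV p q e"
    and coupled_basis_E: "coupled_basis \<rho> p q e E"
begin

lemma e_expansion: "x = (\<Sum>l\<in>gt_labels p q. cscale (cinner (e l) x) (e l))"
proof -
  have "x \<in> {\<Sum>l\<in>gt_labels p q. cscale (a l) (e l) | a. True}"
    using gt_basis_e unfolding gt_basis_def by blast
  then obtain a where "x = (\<Sum>l\<in>gt_labels p q. cscale (a l) (e l))" by blast
  then show ?thesis
    using gt_basis_e unfolding gt_basis_def
    by (intro orthonormal_expansion[OF finite_gt_labels]) auto
qed

text \<open>Preservation of the inner product forces a trivial kernel. Invertibility turns
  \<open>matrix_inv\<close> in \<open>conj_action\<close> into a true inverse.\<close>

lemma invertible_rho:
  assumes "g \<in> SU3"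
  shows "invertible (\<rho> g)"
proof -
  have "cinner (\<rho> g *v x) (\<rho> g *v x) = cinner x x" for x
    using gt_basis_e assms unfolding gt_basis_def irrep_on_def unitary_rep_def by blast
  then have "x = 0" if "\<rho> g *v x = 0" for x
    using that by (metis Re_cinner cinner.zero_left inner_eq_zero_iff zero_complex.simps(1))
  then have "\<exists>B. B ** \<rho> g = mat 1" by (simp add: matrix_left_invertible_ker)
  then show ?thesis by (simp add: invertible_left_inverse)
qed

lemmas operator_decomposition = coupled_basis_E[unfolded coupled_basis_def, THEN conjunct1]

lemma gt_basis_E: "n \<le> p + q \<Longrightarrow> \<exists>V. gt_basis (conj_action \<rho>) V n n (E n)"
  using coupled_basis_E unfolding coupled_basis_def by blast

lemma unitary_rep_conj: "unitary_rep (conj_action \<rho>)"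
  using gt_basis_E[of 0] unfolding gt_basis_def irrep_on_def by blast

text \<open>Inside a summand this is part of \<open>gt_basis\<close>; distinct summands are
  orthogonal, and each basis operator lies in its own summand.\<close>

lemma E_orthonormal:
  assumes "m \<le> p + q" "n \<le> p + q" "k \<in> gt_labels m m" "l \<in> gt_labels n n"
  shows "cinner (E m k) (E n l) = (if m = n \<and> k = l then 1 else 0)"
proof -
  obtain V where basis: "\<forall>n\<le>p + q. gt_basis (conj_action \<rho>) (V n) n n (E n)"
    and orth: "\<forall>m\<le>p + q. \<forall>n\<le>p + q. m \<noteq> n \<longrightarrow> (\<forall>A\<in>V m. \<forall>B\<in>V n. cinner A B = 0)"
    using operator_decomposition by (elim exE conjE)
  note V = basis[rule_format]
  have mem: "E n l \<in> V n" if "n \<le> p + q" "l \<in> gt_labels n n" for n l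
  proof -
    have "E n l = (\<Sum>k\<in>gt_labels n n. if k = l then E n k else 0)"
      using that finite_gt_labels by simp
    also have "\<dots> = (\<Sum>k\<in>gt_labels n n. cscale (if k = l then 1 else 0) (E n k))"
      by (intro sum.cong) auto
    finally have "\<exists>a. E n l = (\<Sum>k\<in>gt_labels n n. cscale (a k) (E n k))"
      by (rule exI[of _ "\<lambda>k. if k = l then 1 else 0"])
    moreover have "V n = {\<Sum>k\<in>gt_labels n n. cscale (a k) (E n k) | a. True}"
      using V[OF that(1)] unfolding gt_basis_def by blast
    ultimately show ?thesis by blast
  qed
  show ?thesis
  proof (cases "m = n")
    case True
    then show ?thesis using V[OF assms(1)] assms unfolding gt_basis_def by auto
  next
    case False
    then show ?thesis using orth assms mem by simp
  qed
qed

text \<open>The decomposition gives coefficients for each \<open>n\<close> separately. Flattening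
  the double index into one \<open>SIGMA\<close> set lets \<open>orthonormal_expansion\<close>
  identify them all.\<close>

lemma E_expansion:
  "A = (\<Sum>n\<le>p + q. \<Sum>l\<in>gt_labels n n. cscale (cinner (E n l) A) (E n l))"
proof -
  let ?I = "SIGMA n:{..p + q}. gt_labels n n"
  obtain V where basis: "\<forall>n\<le>p + q. gt_basis (conj_action \<rho>) (V n) n n (E n)"
    and span: "\<forall>A. \<exists>B. (\<forall>n\<le>p + q. B n \<in> V n) \<and> A = (\<Sum>n\<le>p + q. B n)"
    using operator_decomposition by (elim exE conjE)
  note V = basis[rule_format]
  obtain B where mem: "\<forall>n\<le>p + q. B n \<in> V n" and A_sum: "A = (\<Sum>n\<le>p + q. B n)"
    using span[THEN spec, of A] by (elim exE conjE)
  have "\<exists>a. B n = (\<Sum>l\<in>gt_labels n n. cscale (a l) (E n l))" if "n \<le> p + q" for n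
    using mem[rule_format, OF that] V[OF that] unfolding gt_basis_def by blast
  then have "\<forall>n. \<exists>a. n \<le> p + q \<longrightarrow> B n = (\<Sum>l\<in>gt_labels n n. cscale (a l) (E n l))"
    by blast
  from choice[OF this] obtain a
    where "\<forall>n. n \<le> p + q \<longrightarrow> B n = (\<Sum>l\<in>gt_labels n n. cscale (a n l) (E n l))" ..
  then have "A = (\<Sum>n\<le>p + q. \<Sum>l\<in>gt_labels n n. cscale (a n l) (E n l))"
    unfolding A_sum by (intro sum.cong) simp_all
  also have "\<dots> = (\<Sum>i\<in>?I. cscale (a (fst i) (snd i)) (E (fst i) (snd i)))"
    by (subst sum.Sigma) (auto simp: finite_gt_labels split_def)
  finally have A: "A = \<dots>" .
  have on: "cinner (E (fst i) (snd i)) (E (fst j) (snd j)) = (if i = j then 1 else 0)"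
    if "i \<in> ?I" "j \<in> ?I" for i j
    using that by (cases i; cases j) (simp add: E_orthonormal)
  have "A = (\<Sum>i\<in>?I. cscale (cinner (E (fst i) (snd i)) A) (E (fst i) (snd i)))"
    by (rule orthonormal_expansion[OF _ on A]) (simp_all add: finite_gt_labels)
  also have "\<dots> = (\<Sum>n\<le>p + q. \<Sum>l\<in>gt_labels n n. cscale (cinner (E n l) A) (E n l))"
    by (subst sum.Sigma) (auto simp: finite_gt_labels split_def)
  finally show ?thesis .
qed

lemma eq_if_components_eq:
  assumes "\<And>n l. n \<le> p + q \<Longrightarrow> l \<in> gt_labels n n \<Longrightarrow> cinner (E n l) A = cinner (E n l) B"
  shows "A = B"
proof -
  have "A = (\<Sum>n\<le>p + q. \<Sum>l\<in>gt_labels n n. cscale (cinner (E n l) A) (E n l))"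
    by (rule E_expansion)
  also have "\<dots> = (\<Sum>n\<le>p + q. \<Sum>l\<in>gt_labels n n. cscale (cinner (E n l) B) (E n l))"
    by (intro sum.cong refl) (simp add: assms)
  also have "\<dots> = B"
    by (rule E_expansion[symmetric])
  finally show ?thesis .
qed

section \<open>The Leibniz rule and the ladder operators\<close>

lemmas lie_sl_mult = lie_sl_conj_action_mult[OF unitary_rep_conj _ invertible_rho]
lemmas adjoint = lie_sl_adjoint[OF unitary_rep_conj]

lemma U_minus_E:
  assumes "n \<le> p + q" "(\<nu>, J) \<in> gt_labels n n"
  shows "U_minus (conj_action \<rho>) (E n (\<nu>, J)) = gt_coeff_U \<nu> J *\<^sub>R E n (u_shift (- 1) \<nu>, J)"
proof -
  obtain V where "gt_basis (conj_action \<rho>) V n n (E n)" using gt_basis_E[OF assms(1)] ..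
  then show ?thesis
    using assms(2) unfolding gt_basis_def by (cases \<nu>) (auto simp: Let_def)
qed

lemma weights_E:
  assumes "n \<le> p + q" "(\<nu>, J) \<in> gt_labels n n"
  shows "T_three (conj_action \<rho>) (E n (\<nu>, J)) = t_of \<nu> *\<^sub>R E n (\<nu>, J)"
    and "U_three (conj_action \<rho>) (E n (\<nu>, J)) = u_of \<nu> *\<^sub>R E n (\<nu>, J)"
proof -
  obtain V where "gt_basis (conj_action \<rho>) V n n (E n)" using gt_basis_E[OF assms(1)] ..
  then show "T_three (conj_action \<rho>) (E n (\<nu>, J)) = t_of \<nu> *\<^sub>R E n (\<nu>, J)"
    "U_three (conj_action \<rho>) (E n (\<nu>, J)) = u_of \<nu> *\<^sub>R E n (\<nu>, J)"
    using assms(2) unfolding gt_basis_def by (cases \<nu>; auto simp: Let_def)+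
qed

lemma U_adjoint:
  "cinner (U_minus (conj_action \<rho>) A) B = cinner A (U_plus (conj_action \<rho>) B)"
  "cinner (U_plus (conj_action \<rho>) A) B = cinner A (U_minus (conj_action \<rho>) B)"
  unfolding U_minus_def U_plus_def
  by (subst adjoint; simp add: traceless_generators dagger_generators)+

lemma U_mult:
  "U_minus (conj_action \<rho>) (A ** B) = U_minus (conj_action \<rho>) A ** B + A ** U_minus (conj_action \<rho>) B"
  "U_plus (conj_action \<rho>) (A ** B) = U_plus (conj_action \<rho>) A ** B + A ** U_plus (conj_action \<rho>) B"
  unfolding U_minus_def U_plus_def by (rule lie_sl_mult; simp add: traceless_generators)+

text \<open>\<open>gt_basis\<close> prescribes only the lowering operator; the raising one is its
  adjoint, computed here component by component.\<close>

lemma U_plus_E: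
  assumes n: "n \<le> p + q" and l: "(\<nu>, J) \<in> gt_labels n n"
  shows "U_plus (conj_action \<rho>) (E n (\<nu>, J)) =
    gt_coeff_U (u_shift 1 \<nu>) J *\<^sub>R E n (u_shift 1 \<nu>, J)"
proof (rule eq_if_components_eq)
  fix m k assume m: "m \<le> p + q" and k: "k \<in> gt_labels m m"
  obtain \<mu> K where k_eq: "k = (\<mu>, K)" by (cases k)
  obtain i j where ij: "J - u_of \<nu> = real i" "J + u_of \<nu> = real j"
    using gt_label_weights[OF l] .
  obtain i' j' where ij': "K - u_of \<mu> = real i'" "K + u_of \<mu> = real j'"
    using gt_label_weights k unfolding k_eq by metis
  have eq: "cinner (E m k) (U_plus (conj_action \<rho>) (E n (\<nu>, J))) =
      of_real (gt_coeff_U \<mu> K) * cinner (E m (u_shift (- 1) \<mu>, K)) (E n (\<nu>, J))"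
    unfolding U_adjoint(1)[symmetric] k_eq
    by (simp add: U_minus_E m k[unfolded k_eq] cinner_scaleR_left)
  \<comment> \<open>At the bottom of a multiplet the shifted pair is no label and \<open>E\<close>
    is unspecified there, but the ladder coefficient vanishes. The same happens at the top in
    \<open>high\<close>.\<close>
  have low: "of_real (gt_coeff_U \<mu> K) * cinner (E m (u_shift (- 1) \<mu>, K)) (E n (\<nu>, J)) =
      (if - K < u_of \<mu> \<and> m = n \<and> u_shift (- 1) \<mu> = \<nu> \<and> K = J then of_real (gt_coeff_U \<mu> K) else 0)"
  proof (cases "- K < u_of \<mu>")
    case True
    then show ?thesis
      using E_orthonormal[OF m n u_shift_in_gt_labels(2)[OF k[unfolded k_eq]] l] by auto
  next
    case False
    then have "K + u_of \<mu> = 0" using ij' by linarith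
    then show ?thesis using False by (simp add: gt_coeff_U_def)
  qed
  have high: "of_real (gt_coeff_U (u_shift 1 \<nu>) J) * cinner (E m (\<mu>, K)) (E n (u_shift 1 \<nu>, J)) =
      (if u_of \<nu> < J \<and> m = n \<and> \<mu> = u_shift 1 \<nu> \<and> K = J then of_real (gt_coeff_U (u_shift 1 \<nu>) J) else 0)"
  proof (cases "u_of \<nu> < J")
    case True
    then show ?thesis
      using E_orthonormal[OF m n k[unfolded k_eq] u_shift_in_gt_labels(1)[OF l]] by auto
  next
    case False
    then have "J - u_of \<nu> = 0" using ij by linarith
    then show ?thesis using False by (simp add: gt_coeff_U_def)
  qed
  have iff: "(- K < u_of \<mu> \<and> m = n \<and> u_shift (- 1) \<mu> = \<nu> \<and> K = J) \<longleftrightarrow>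
      (u_of \<nu> < J \<and> m = n \<and> \<mu> = u_shift 1 \<nu> \<and> K = J)" (is "_ \<longleftrightarrow> ?P")
    using ij ij' by auto
  have "cinner (E m k) (U_plus (conj_action \<rho>) (E n (\<nu>, J))) = (if ?P then of_real (gt_coeff_U \<mu> K) else 0)"
    by (simp only: eq low iff)
  also have "\<dots> = (if ?P then of_real (gt_coeff_U (u_shift 1 \<nu>) J) else 0)"
    by auto
  also have "\<dots> = cinner (E m k) (gt_coeff_U (u_shift 1 \<nu>) J *\<^sub>R E n (u_shift 1 \<nu>, J))"
    by (simp only: cinner_scaleR_right high k_eq)
  finally show "cinner (E m k) (U_plus (conj_action \<rho>) (E n (\<nu>, J))) =
      cinner (E m k) (gt_coeff_U (u_shift 1 \<nu>) J *\<^sub>R E n (u_shift 1 \<nu>, J))" .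
qed

end

section \<open>Selection rules and the twisted product\<close>

text \<open>A ladder coefficient vanishes exactly at the end of its multiplet. Hence every nonzero
  Leibniz term below involves only genuine labels.\<close>

lemma gt_coeff_U_nonzero_iff:
  assumes "(\<nu>, J) \<in> gt_labels p q"
  shows "gt_coeff_U \<nu> J \<noteq> 0 \<longleftrightarrow> - J < u_of \<nu>"
    and "gt_coeff_U (u_shift 1 \<nu>) J \<noteq> 0 \<longleftrightarrow> u_of \<nu> < J"
proof -
  obtain i j where "J - u_of \<nu> = real i" "J + u_of \<nu> = real j"
    using gt_label_weights[OF assms] .
  then show "gt_coeff_U \<nu> J \<noteq> 0 \<longleftrightarrow> - J < u_of \<nu>"
    "gt_coeff_U (u_shift 1 \<nu>) J \<noteq> 0 \<longleftrightarrow> u_of \<nu> < J"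
    by (auto simp: gt_coeff_U_def)
qed

context gt_coupled_basis
begin

text \<open>A Cartan generator is self-adjoint: acting on the left entry it yields one eigenvalue,
  acting on the product by the Leibniz rule it yields the sum of two. A nonzero matrix element makes
  them equal.\<close>

lemma weight_selection:
  assumes "n \<le> p + q" "m \<le> p + q" "k \<le> p + q"
    and "(\<nu>, J) \<in> gt_labels n n" "(\<mu>, K) \<in> gt_labels m m" "(\<kappa>, L) \<in> gt_labels k k"
    and nz: "cinner (E n (\<nu>, J)) (E m (\<mu>, K) ** E k (\<kappa>, L)) \<noteq> 0"
  shows "t_of \<nu> = t_of \<mu> + t_of \<kappa>" and "u_of \<nu> = u_of \<mu> + u_of \<kappa>"
proof -
  have *: "c = a + b"
    if "trace Z = 0" "dagger Z = Z" "lie_sl (conj_action \<rho>) Z (E n (\<nu>, J)) = c *\<^sub>R E n (\<nu>, J)"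
      "lie_sl (conj_action \<rho>) Z (E m (\<mu>, K)) = a *\<^sub>R E m (\<mu>, K)"
      "lie_sl (conj_action \<rho>) Z (E k (\<kappa>, L)) = b *\<^sub>R E k (\<kappa>, L)" for Z a b c
  proof -
    let ?x = "cinner (E n (\<nu>, J)) (E m (\<mu>, K) ** E k (\<kappa>, L))"
    have "of_real c * ?x = of_real (a + b) * ?x"
      using adjoint[OF that(1), of "E n (\<nu>, J)" "E m (\<mu>, K) ** E k (\<kappa>, L)"]
      by (simp add: that lie_sl_mult cinner_scaleR_left cinner_scaleR_right cinner.add_right
          matmul.scaleR_left matmul.scaleR_right distrib_right)
    with nz show ?thesis by (metis mult_right_cancel of_real_eq_iff)
  qed
  show "t_of \<nu> = t_of \<mu> + t_of \<kappa>"
    using assms by (intro *[OF traceless_generators(3) dagger_generators(2)])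
      (simp_all add: weights_E(1) flip: T_three_def)
  show "u_of \<nu> = u_of \<mu> + u_of \<kappa>"
    using assms by (intro *[OF traceless_generators(4) dagger_generators(2)])
      (simp_all add: weights_E(2) flip: U_three_def)
qed

text \<open>The invariant of the climb: the spins and summands are fixed while the three labels
  move, and label membership travels along with nonvanishing.\<close>

definition nonzero_component ::
    "nat \<Rightarrow> nat \<Rightarrow> nat \<Rightarrow> real \<Rightarrow> real \<Rightarrow> real \<Rightarrow> nu \<Rightarrow> nu \<Rightarrow> nu \<Rightarrow> bool" where
  "nonzero_component n m k J K L \<nu> \<mu> \<kappa> \<longleftrightarrow>
    n \<le> p + q \<and> m \<le> p + q \<and> k \<le> p + q \<and>
    (\<nu>, J) \<in> gt_labels n n \<and> (\<mu>, K) \<in> gt_labels m m \<and> (\<kappa>, L) \<in> gt_labels k k \<and>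
    cinner (E n (\<nu>, J)) (E m (\<mu>, K) ** E k (\<kappa>, L)) \<noteq> 0"

text \<open>The given element is, up to a nonzero factor, the one with \<open>U_minus\<close>
  applied to the raised output. Moving it across as \<open>U_plus\<close> and using the Leibniz rule
  leaves two terms, not both zero.\<close>

lemma raise_output:
  assumes nz: "nonzero_component n m k J K L \<nu> \<mu> \<kappa>" and less: "u_of \<nu> < J"
  shows "\<exists>\<mu>' \<kappa>'. nonzero_component n m k J K L (u_shift 1 \<nu>) \<mu>' \<kappa>'"
proof -
  note labels = nz[unfolded nonzero_component_def]
  let ?C = "E n (u_shift 1 \<nu>, J)" and ?A = "E m (\<mu>, K)" and ?B = "E k (\<kappa>, L)"
  let ?a = "gt_coeff_U (u_shift 1 \<mu>) K" and ?b = "gt_coeff_U (u_shift 1 \<kappa>) L"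
  let ?c = "gt_coeff_U (u_shift 1 \<nu>) J"
  have up: "(u_shift 1 \<nu>, J) \<in> gt_labels n n"
    using u_shift_in_gt_labels(1) labels less by blast
  have "of_real ?c * cinner (E n (\<nu>, J)) (?A ** ?B) = cinner (U_minus (conj_action \<rho>) ?C) (?A ** ?B)"
    using labels up by (simp add: U_minus_E cinner_scaleR_left)
  also have "\<dots> = of_real ?a * cinner ?C (E m (u_shift 1 \<mu>, K) ** ?B) +
      of_real ?b * cinner ?C (?A ** E k (u_shift 1 \<kappa>, L))"
    using labels by (simp add: U_adjoint(1) U_mult U_plus_E cinner.add_right matmul.scaleR_left
        matmul.scaleR_right cinner_scaleR_right)
  finally have "of_real ?a * cinner ?C (E m (u_shift 1 \<mu>, K) ** ?B) \<noteq> 0 \<or>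
      of_real ?b * cinner ?C (?A ** E k (u_shift 1 \<kappa>, L)) \<noteq> 0"
    using gt_coeff_U_nonzero_iff(2)[of \<nu> J n n] labels less by auto
  then show ?thesis
  proof
    assume a: "of_real ?a * cinner ?C (E m (u_shift 1 \<mu>, K) ** ?B) \<noteq> 0"
    then have "u_of \<mu> < K" using gt_coeff_U_nonzero_iff(2)[of \<mu> K m m] labels by auto
    then have "nonzero_component n m k J K L (u_shift 1 \<nu>) (u_shift 1 \<mu>) \<kappa>"
      using a labels up u_shift_in_gt_labels(1)[of \<mu> K] by (simp add: nonzero_component_def)
    then show ?thesis by blast
  next
    assume b: "of_real ?b * cinner ?C (?A ** E k (u_shift 1 \<kappa>, L)) \<noteq> 0"
    then have "u_of \<kappa> < L" using gt_coeff_U_nonzero_iff(2)[of \<kappa> L k k] labels by auto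
    then have "nonzero_component n m k J K L (u_shift 1 \<nu>) \<mu> (u_shift 1 \<kappa>)"
      using b labels up u_shift_in_gt_labels(1)[of \<kappa> L] by (simp add: nonzero_component_def)
    then show ?thesis by blast
  qed
qed

text \<open>With the left factor raised, \<open>U_minus\<close> on the product returns the given
  nonzero element plus a term lowering the right factor. The adjoint side raises the output, so one
  of these two other terms is nonzero.\<close>

lemma raise_left:
  assumes nz: "nonzero_component n m k J K L \<nu> \<mu> \<kappa>" and less: "u_of \<mu> < K"
  shows "\<exists>\<nu>' \<kappa>'. nonzero_component n m k J K L \<nu>' (u_shift 1 \<mu>) \<kappa>'"
proof -
  note labels = nz[unfolded nonzero_component_def]
  let ?C = "E n (\<nu>, J)" and ?A = "E m (u_shift 1 \<mu>, K)" and ?B = "E k (\<kappa>, L)"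
  let ?a = "gt_coeff_U (u_shift 1 \<mu>) K" and ?b = "gt_coeff_U \<kappa> L"
  let ?c = "gt_coeff_U (u_shift 1 \<nu>) J"
  have up: "(u_shift 1 \<mu>, K) \<in> gt_labels m m"
    using u_shift_in_gt_labels(1) labels less by blast
  have "of_real ?c * cinner (E n (u_shift 1 \<nu>, J)) (?A ** ?B) =
      cinner (U_plus (conj_action \<rho>) ?C) (?A ** ?B)"
    using labels by (simp add: U_plus_E cinner_scaleR_left)
  also have "\<dots> = of_real ?a * cinner ?C (E m (\<mu>, K) ** ?B) +
      of_real ?b * cinner ?C (?A ** E k (u_shift (- 1) \<kappa>, L))"
    using labels up by (simp add: U_adjoint(2) U_mult U_minus_E cinner.add_right matmul.scaleR_left
        matmul.scaleR_right cinner_scaleR_right)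
  finally have "of_real ?c * cinner (E n (u_shift 1 \<nu>, J)) (?A ** ?B) \<noteq> 0 \<or>
      of_real ?b * cinner ?C (?A ** E k (u_shift (- 1) \<kappa>, L)) \<noteq> 0"
    using gt_coeff_U_nonzero_iff(2)[of \<mu> K m m] labels less by auto
  then show ?thesis
  proof
    assume c: "of_real ?c * cinner (E n (u_shift 1 \<nu>, J)) (?A ** ?B) \<noteq> 0"
    then have "u_of \<nu> < J" using gt_coeff_U_nonzero_iff(2)[of \<nu> J n n] labels by auto
    then have "nonzero_component n m k J K L (u_shift 1 \<nu>) (u_shift 1 \<mu>) \<kappa>"
      using c labels up u_shift_in_gt_labels(1)[of \<nu> J] by (simp add: nonzero_component_def)
    then show ?thesis by blast
  next
    assume b: "of_real ?b * cinner ?C (?A ** E k (u_shift (- 1) \<kappa>, L)) \<noteq> 0"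
    then have "- L < u_of \<kappa>" using gt_coeff_U_nonzero_iff(1)[of \<kappa> L k k] labels by auto
    then have "nonzero_component n m k J K L \<nu> (u_shift 1 \<mu>) (u_shift (- 1) \<kappa>)"
      using b labels up u_shift_in_gt_labels(2)[of \<kappa> L] by (simp add: nonzero_component_def)
    then show ?thesis by blast
  qed
qed

text \<open>The mirror image of \<open>raise_left\<close>: now the left factor is the one that may
  be lowered.\<close>

lemma raise_right:
  assumes nz: "nonzero_component n m k J K L \<nu> \<mu> \<kappa>" and less: "u_of \<kappa> < L"
  shows "\<exists>\<nu>' \<mu>'. nonzero_component n m k J K L \<nu>' \<mu>' (u_shift 1 \<kappa>)"
proof -
  note labels = nz[unfolded nonzero_component_def]
  let ?C = "E n (\<nu>, J)" and ?A = "E m (\<mu>, K)" and ?B = "E k (u_shift 1 \<kappa>, L)"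
  let ?a = "gt_coeff_U \<mu> K" and ?b = "gt_coeff_U (u_shift 1 \<kappa>) L"
  let ?c = "gt_coeff_U (u_shift 1 \<nu>) J"
  have up: "(u_shift 1 \<kappa>, L) \<in> gt_labels k k"
    using u_shift_in_gt_labels(1) labels less by blast
  have "of_real ?c * cinner (E n (u_shift 1 \<nu>, J)) (?A ** ?B) =
      cinner (U_plus (conj_action \<rho>) ?C) (?A ** ?B)"
    using labels by (simp add: U_plus_E cinner_scaleR_left)
  also have "\<dots> = of_real ?a * cinner ?C (E m (u_shift (- 1) \<mu>, K) ** ?B) +
      of_real ?b * cinner ?C (?A ** E k (\<kappa>, L))"
    using labels up by (simp add: U_adjoint(2) U_mult U_minus_E cinner.add_right matmul.scaleR_left
        matmul.scaleR_right cinner_scaleR_right)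
  finally have "of_real ?c * cinner (E n (u_shift 1 \<nu>, J)) (?A ** ?B) \<noteq> 0 \<or>
      of_real ?a * cinner ?C (E m (u_shift (- 1) \<mu>, K) ** ?B) \<noteq> 0"
    using gt_coeff_U_nonzero_iff(2)[of \<kappa> L k k] labels less by auto
  then show ?thesis
  proof
    assume c: "of_real ?c * cinner (E n (u_shift 1 \<nu>, J)) (?A ** ?B) \<noteq> 0"
    then have "u_of \<nu> < J" using gt_coeff_U_nonzero_iff(2)[of \<nu> J n n] labels by auto
    then have "nonzero_component n m k J K L (u_shift 1 \<nu>) \<mu> (u_shift 1 \<kappa>)"
      using c labels up u_shift_in_gt_labels(1)[of \<nu> J] by (simp add: nonzero_component_def)
    then show ?thesis by blast
  next
    assume a: "of_real ?a * cinner ?C (E m (u_shift (- 1) \<mu>, K) ** ?B) \<noteq> 0"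
    then have "- K < u_of \<mu>" using gt_coeff_U_nonzero_iff(1)[of \<mu> K m m] labels by auto
    then have "nonzero_component n m k J K L \<nu> (u_shift (- 1) \<mu>) (u_shift 1 \<kappa>)"
      using a labels up u_shift_in_gt_labels(2)[of \<mu> K] by (simp add: nonzero_component_def)
    then show ?thesis by blast
  qed
qed

text \<open>Each weight in turn is climbed to its top, where additivity bounds the corresponding
  spin by the sum of the other two.\<close>

lemma triangle_selection:
  assumes nz: "nonzero_component n m k J K L \<nu> \<mu> \<kappa>"
  shows "tri_delta K L J = 1"
proof -
  have weights: "u_of \<nu>' = u_of \<mu>' + u_of \<kappa>'" "\<bar>u_of \<nu>'\<bar> \<le> J" "\<bar>u_of \<mu>'\<bar> \<le> K" "\<bar>u_of \<kappa>'\<bar> \<le> L"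
    if "nonzero_component n m k J K L \<nu>' \<mu>' \<kappa>'" for \<nu>' \<mu>' \<kappa>'
  proof -
    note labels = that[unfolded nonzero_component_def]
    show "u_of \<nu>' = u_of \<mu>' + u_of \<kappa>'"
      by (rule weight_selection(2)[of n m k]) (use labels in auto)
    have "\<bar>u_of \<alpha>\<bar> \<le> j" if "(\<alpha>, j) \<in> gt_labels i i" for \<alpha> j i
      by (rule gt_label_weights[OF that]) linarith
    then show "\<bar>u_of \<nu>'\<bar> \<le> J" "\<bar>u_of \<mu>'\<bar> \<le> K" "\<bar>u_of \<kappa>'\<bar> \<le> L" using labels by blast+
  qed
  note labels = nz[unfolded nonzero_component_def]
  obtain i i' where i: "J - u_of \<nu> = real i" "J + u_of \<nu> = real i'"
    using labels gt_label_weights by metis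
  obtain j j' where j: "K - u_of \<mu> = real j" "K + u_of \<mu> = real j'"
    using labels gt_label_weights by metis
  obtain l l' where l: "L - u_of \<kappa> = real l" "L + u_of \<kappa> = real l'"
    using labels gt_label_weights by metis
  \<comment> \<open>By additivity the weights cancel in (K - u of \<mu>) + (L - u of \<kappa>) + (J
    + u of \<nu>), whose brackets are natural numbers.\<close>
  have "K + L + J = real (j + l + i')"
    using weights(1)[OF nz] i j l by simp
  then have int: "K + L + J \<in> \<int>" by (metis Ints_of_nat)
  have "\<exists>\<nu>' \<mu>' \<kappa>'. nonzero_component n m k J K L \<nu>' \<mu>' \<kappa>' \<and> u_of \<nu>' = J"
  proof (rule climb[where Q = "\<lambda>y. \<exists>\<nu>' \<mu>' \<kappa>'. nonzero_component n m k J K L \<nu>' \<mu>' \<kappa>' \<and> u_of \<nu>' = y",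
        OF _ i(1)])
    fix y assume "\<exists>\<nu>' \<mu>' \<kappa>'. nonzero_component n m k J K L \<nu>' \<mu>' \<kappa>' \<and> u_of \<nu>' = y" "y < J"
    then obtain \<nu>' \<mu>' \<kappa>' where y: "nonzero_component n m k J K L \<nu>' \<mu>' \<kappa>'" "u_of \<nu>' = y" "u_of \<nu>' < J"
      by auto
    obtain \<mu>'' \<kappa>'' where "nonzero_component n m k J K L (u_shift 1 \<nu>') \<mu>'' \<kappa>''"
      using raise_output[OF y(1,3)] by (elim exE)
    moreover have "u_of (u_shift 1 \<nu>') = y + 1" using y(2) by simp
    ultimately show "\<exists>\<nu>' \<mu>' \<kappa>'. nonzero_component n m k J K L \<nu>' \<mu>' \<kappa>' \<and> u_of \<nu>' = y + 1"
      by (intro exI conjI)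
  qed (use nz in blast)
  then obtain \<nu>' \<mu>' \<kappa>'
    where "nonzero_component n m k J K L \<nu>' \<mu>' \<kappa>'" "u_of \<nu>' = J"
    by (elim exE conjE)
  then have "J \<le> K + L" using weights[of \<nu>' \<mu>' \<kappa>'] by auto
  \<comment> \<open>At the top of the left factor, \<open>K\<close> is the output weight minus the
    right weight, at most \<open>J + L\<close>.\<close>
  moreover have "\<exists>\<nu>' \<mu>' \<kappa>'. nonzero_component n m k J K L \<nu>' \<mu>' \<kappa>' \<and> u_of \<mu>' = K"
  proof (rule climb[where Q = "\<lambda>y. \<exists>\<nu>' \<mu>' \<kappa>'. nonzero_component n m k J K L \<nu>' \<mu>' \<kappa>' \<and> u_of \<mu>' = y",
        OF _ j(1)])
    fix y assume "\<exists>\<nu>' \<mu>' \<kappa>'. nonzero_component n m k J K L \<nu>' \<mu>' \<kappa>' \<and> u_of \<mu>' = y" "y < K"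
    then obtain \<nu>' \<mu>' \<kappa>' where y: "nonzero_component n m k J K L \<nu>' \<mu>' \<kappa>'" "u_of \<mu>' = y" "u_of \<mu>' < K"
      by auto
    obtain \<nu>'' \<kappa>'' where "nonzero_component n m k J K L \<nu>'' (u_shift 1 \<mu>') \<kappa>''"
      using raise_left[OF y(1,3)] by (elim exE)
    moreover have "u_of (u_shift 1 \<mu>') = y + 1" using y(2) by simp
    ultimately show "\<exists>\<nu>' \<mu>' \<kappa>'. nonzero_component n m k J K L \<nu>' \<mu>' \<kappa>' \<and> u_of \<mu>' = y + 1"
      by (intro exI conjI)
  qed (use nz in blast)
  then obtain \<nu>' \<mu>' \<kappa>'
    where "nonzero_component n m k J K L \<nu>' \<mu>' \<kappa>'" "u_of \<mu>' = K"
    by (elim exE conjE)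
  then have "K \<le> L + J" using weights[of \<nu>' \<mu>' \<kappa>'] by auto
  moreover have "\<exists>\<nu>' \<mu>' \<kappa>'. nonzero_component n m k J K L \<nu>' \<mu>' \<kappa>' \<and> u_of \<kappa>' = L"
  proof (rule climb[where Q = "\<lambda>y. \<exists>\<nu>' \<mu>' \<kappa>'. nonzero_component n m k J K L \<nu>' \<mu>' \<kappa>' \<and> u_of \<kappa>' = y",
        OF _ l(1)])
    fix y assume "\<exists>\<nu>' \<mu>' \<kappa>'. nonzero_component n m k J K L \<nu>' \<mu>' \<kappa>' \<and> u_of \<kappa>' = y" "y < L"
    then obtain \<nu>' \<mu>' \<kappa>' where y: "nonzero_component n m k J K L \<nu>' \<mu>' \<kappa>'" "u_of \<kappa>' = y" "u_of \<kappa>' < L"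
      by auto
    obtain \<nu>'' \<mu>'' where "nonzero_component n m k J K L \<nu>'' \<mu>'' (u_shift 1 \<kappa>')"
      using raise_right[OF y(1,3)] by (elim exE)
    moreover have "u_of (u_shift 1 \<kappa>') = y + 1" using y(2) by simp
    ultimately show "\<exists>\<nu>' \<mu>' \<kappa>'. nonzero_component n m k J K L \<nu>' \<mu>' \<kappa>' \<and> u_of \<kappa>' = y + 1"
      by (intro exI conjI)
  qed (use nz in blast)
  then obtain \<nu>' \<mu>' \<kappa>'
    where "nonzero_component n m k J K L \<nu>' \<mu>' \<kappa>'" "u_of \<kappa>' = L"
    by (elim exE conjE)
  then have "L \<le> K + J" using weights[of \<nu>' \<mu>' \<kappa>'] by auto
  ultimately show ?thesis using int by (simp add: tri_delta_def)
qed

section \<open>The twisted product of harmonics\<close>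

lemma symbol_eq_cinner:
  assumes "n \<le> p + q" "n1 \<le> p + q" "n2 \<le> p + q"
    and "(\<nu>, J) \<in> gt_labels n n" "l1 \<in> gt_labels n1 n1" "l2 \<in> gt_labels n2 n2"
  shows "(-1) powi (int (p + q) + tu2 \<nu>) *
      wigner_product_symbol p q e E n1 n2 n l1 l2 (check (2 * n) \<nu>, J) =
    cinner (E n (\<nu>, J)) (E n1 l1 ** E n2 l2)"
  using coupled_basis_E assms unfolding coupled_basis_def
  by (intro wigner_product_symbol_eq_cinner e_expansion) auto

end

theorem theorem4p25:
  fixes p a b :: nat
    and \<rho> :: "complex ^ 3 ^ 3 \<Rightarrow> complex ^ 'd ^ 'd"
    and e :: "nu \<times> real \<Rightarrow> complex ^ 'd"
    and E :: "nat \<Rightarrow> nu \<times> real \<Rightarrow> complex ^ 'd ^ 'd"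
    and \<pi> :: "nat \<Rightarrow> complex ^ 3 ^ 3 \<Rightarrow> 'v::chilbert \<Rightarrow> 'v"
    and V :: "nat \<Rightarrow> 'v set"
    and f :: "nat \<Rightarrow> nu \<times> real \<Rightarrow> 'v"
    and M :: "cp2 measure"
    and W :: "complex ^ 'd ^ 'd \<Rightarrow> cp2 \<Rightarrow> complex"
    and c :: "nat \<Rightarrow> real"
  assumes "p \<ge> 1"
    and "(a, b) = (p, 0) \<or> (a, b) = (0, p)"
    and "gt_basis (\<lambda>g v. \<rho> g *v v) UNIV a b e"
    and "coupled_basis \<rho> a b e E"
    and "\<And>n. n \<le> p \<Longrightarrow> gt_basis (\<pi> n) (V n) n n (f n)"
    and "invariant_measure M"
    and "symbol_correspondence \<rho> a b M W"
    and "characteristic_numbers a b E (harmonic \<pi> f) W c"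
    and "n1 \<le> p" and "n2 \<le> p"
    and "(\<nu>1, J1) \<in> gt_labels n1 n1"
    and "(\<nu>2, J2) \<in> gt_labels n2 n2"
  shows "twisted_product W (harmonic \<pi> f n1 (\<nu>1, J1)) (harmonic \<pi> f n2 (\<nu>2, J2)) =
      (\<lambda>x. complex_of_real (sqrt (irrep_dim a b)) *
        (\<Sum>n\<le>p. \<Sum>(\<nu>, J)\<in>gt_labels n n.
           (-1) powi (int p + tu2 \<nu>) *
           wigner_product_symbol a b e E n1 n2 n (\<nu>1, J1) (\<nu>2, J2) (check (2 * n) \<nu>, J) *
           complex_of_real (c n / (c n1 * c n2)) * harmonic \<pi> f n (\<nu>, J) x))
    \<and> (\<forall>n\<le>p. \<forall>(\<nu>, J)\<in>gt_labels n n.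
         wigner_product_symbol a b e E n1 n2 n (\<nu>1, J1) (\<nu>2, J2) (check (2 * n) \<nu>, J) \<noteq> 0 \<longrightarrow>
           t_of \<nu> = t_of \<nu>1 + t_of \<nu>2 \<and> u_of \<nu> = u_of \<nu>1 + u_of \<nu>2 \<and>
           tri_delta J1 J2 J = 1)"
proof -
  interpret gt_coupled_basis \<rho> a b e E by unfold_locales fact+
  have ab: "a + b = p" using assms(2) by auto
  let ?X = "harmonic \<pi> f" and ?A = "E n1 (\<nu>1, J1)" and ?B = "E n2 (\<nu>2, J2)"
  define D where "D = sqrt (irrep_dim a b)"
  have D: "D > 0" unfolding D_def irrep_dim_def by (simp add: add_nonneg_pos)
  have inj: "inj W" and add: "W (A + B) = (\<lambda>x. W A x + W B x)"
    and scale: "W (cscale z A) = (\<lambda>x. z * W A x)" for A B z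
    using assms(7) by (simp_all add: symbol_correspondence_def)
  \<comment> \<open>Nonvanishing at n = 0 comes from \<open>c 0 = 1\<close>, hence the case
    split.\<close>
  have c: "c n \<noteq> 0" and char: "l \<in> gt_labels n n \<Longrightarrow> W (D *\<^sub>R E n l) = (\<lambda>x. of_real (c n) * ?X n l x)"
    if "n \<le> p" for n l
    using assms(8) that unfolding characteristic_numbers_def ab D_def by (cases n; auto)+
  have zero: "W 0 = (\<lambda>x. 0)" using scale[of 0 0] by simp
  have W_sum: "W (\<Sum>i\<in>I. g i) = (\<lambda>x. \<Sum>i\<in>I. W (g i) x)" for I :: "'i set" and g
    by (induction I rule: infinite_finite_induct) (simp_all add: zero add)
  have W_E: "W (E n l) = (\<lambda>x. of_real (c n / D) * ?X n l x)" if "n \<le> p" "l \<in> gt_labels n n" for n l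
  proof -
    have "E n l = cscale (of_real (1 / D)) (D *\<^sub>R E n l)"
      unfolding cscale_of_real using D by simp
    then have "W (E n l) = (\<lambda>x. of_real (1 / D) * W (D *\<^sub>R E n l) x)" by (metis scale)
    then show ?thesis by (simp add: char[OF that])
  qed
  \<comment> \<open>\<open>inv W\<close> is a choice of preimage; injectivity identifies it with
    this multiple of the basis operator.\<close>
  have inv_X: "inv W (?X n l) = (D / c n) *\<^sub>R E n l" if "n \<le> p" "l \<in> gt_labels n n" for n l
  proof -
    have "W ((D / c n) *\<^sub>R E n l) = (\<lambda>x. of_real (D / c n) * W (E n l) x)"
      by (metis scale cscale_of_real)
    also have "\<dots> = ?X n l" using D c[OF that(1)] by (simp add: W_E[OF that])
    finally show ?thesis by (metis inj inv_f_f)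
  qed
  have symbol: "(-1) powi (int p + tu2 \<nu>) *
      wigner_product_symbol a b e E n1 n2 n (\<nu>1, J1) (\<nu>2, J2) (check (2 * n) \<nu>, J) =
      cinner (E n (\<nu>, J)) (?A ** ?B)" if "n \<le> p" "(\<nu>, J) \<in> gt_labels n n" for n \<nu> J
    using symbol_eq_cinner[of n n1 n2 \<nu> J] that assms(9-12) by (simp only: ab)
  have "twisted_product W (?X n1 (\<nu>1, J1)) (?X n2 (\<nu>2, J2)) =
      W (cscale (of_real (D * D / (c n1 * c n2))) (?A ** ?B))"
    unfolding twisted_product_def cscale_of_real
    using assms(9-12) by (simp add: inv_X matmul.scaleR_left matmul.scaleR_right mult_ac)
  also have "\<dots> = (\<lambda>x. of_real (D * D / (c n1 * c n2)) *
      W (\<Sum>n\<le>p. \<Sum>l\<in>gt_labels n n. cscale (cinner (E n l) (?A ** ?B)) (E n l)) x)"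
    using E_expansion[of "?A ** ?B"] unfolding ab scale by simp
  also have "\<dots> = (\<lambda>x. of_real (D * D / (c n1 * c n2)) *
      (\<Sum>n\<le>p. \<Sum>l\<in>gt_labels n n. cinner (E n l) (?A ** ?B) * (of_real (c n / D) * ?X n l x)))"
    unfolding W_sum scale
    by (intro ext arg_cong2[where f = "(*)"] refl sum.cong) (simp add: W_E)
  \<comment> \<open>The two preimages contributed \<open>D * D\<close>; expanding the product in
    symbols divides by one \<open>D\<close>, which leaves the square root of the dimension.\<close>
  also have "\<dots> = (\<lambda>x. of_real D * (\<Sum>n\<le>p. \<Sum>l\<in>gt_labels n n.
      cinner (E n l) (?A ** ?B) * of_real (c n / (c n1 * c n2)) * ?X n l x))"
    using D by (simp add: sum_distrib_left field_simps)
  also have "\<dots> = (\<lambda>x. of_real D * (\<Sum>n\<le>p. \<Sum>(\<nu>, J)\<in>gt_labels n n.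
      (-1) powi (int p + tu2 \<nu>) *
      wigner_product_symbol a b e E n1 n2 n (\<nu>1, J1) (\<nu>2, J2) (check (2 * n) \<nu>, J) *
      of_real (c n / (c n1 * c n2)) * ?X n (\<nu>, J) x))"
    by (intro ext arg_cong2[where f = "(*)"] refl sum.cong) (clarsimp simp: symbol simp del: check.simps tu2.simps)
  finally have product: "twisted_product W (?X n1 (\<nu>1, J1)) (?X n2 (\<nu>2, J2)) = \<dots>" .
  have selection: "t_of \<nu> = t_of \<nu>1 + t_of \<nu>2 \<and> u_of \<nu> = u_of \<nu>1 + u_of \<nu>2 \<and> tri_delta J1 J2 J = 1"
    if "n \<le> p" "(\<nu>, J) \<in> gt_labels n n"
      "wigner_product_symbol a b e E n1 n2 n (\<nu>1, J1) (\<nu>2, J2) (check (2 * n) \<nu>, J) \<noteq> 0" for n \<nu> J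
  proof -
    \<comment> \<open>The symbol and this component differ by a sign only, so they vanish
      together.\<close>
    have "cinner (E n (\<nu>, J)) (?A ** ?B) \<noteq> 0"
      using that unfolding symbol[OF that(1,2), symmetric] by simp
    then have nz: "nonzero_component n n1 n2 J J1 J2 \<nu> \<nu>1 \<nu>2"
      using that assms(9-12) by (simp add: nonzero_component_def ab)
    then have "t_of \<nu> = t_of \<nu>1 + t_of \<nu>2" "u_of \<nu> = u_of \<nu>1 + u_of \<nu>2"
      using weight_selection[of n n1 n2 \<nu> J \<nu>1 J1 \<nu>2 J2] by (simp_all add: nonzero_component_def)
    with triangle_selection[OF nz] show ?thesis by simp
  qed
  show ?thesis using product selection unfolding D_def by blast
qed

end
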